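(* The generating functions $W^{(\mathrm{cl})}(X,Y)$ and $W^{(\mathrm{op})}(X,Y)$ satisfy $$W^{(\mathrm{cl})}(X,Y)=\frac{W^{(\mathrm{op})}(X,Y)\,W^{(\mathrm{op})}(-X,Y)^{-1}}{X\,(X+Y)\,(X-Y)}$$ and $$W^{(\mathrm{cl})}(X,Y)=\frac{2X^2}{\pi}\,\frac{\sin(2\pi X)\,\sin\big(\pi(X+Y)\big)\,\sin\big(\pi(Y-X)\big)}{\Big(\sin\big(\pi(X+Y)\big)+\sin\big(\pi(X-Y)\big)\Big)^2}\;W^{(\mathrm{op})}(X,Y)^2 .$$
   Context: Multiple zeta values: $\zeta(k_1,\ldots,k_m)=\sum_{0<n_1<\cdots<n_m}n_1^{-k_1}\cdots n_m^{-k_m}$. For $k\ge2$, $r\ge0$, $$Z(k,r)=\sum_{\substack{j\ge0,\ (r_1,\dots,r_j)\in\{1,2\}^j\\ r_1+\cdots+r_j=r}}2^{\#\{i\,:\,r_i=1\}}\,\zeta(r_1,\dots,r_j,k),$$ and for $k,r\ge1$, $H(k,r)=\zeta(\underbrace{1,\ldots,1}_{r-1},k+1)$. Put $$\gamma_{n,k}=\sum_{r=0}^{n-k-1}(-2)^{r+2}\binom{n-r+k-3}{2k-2}Z(k+n-r,r)\quad(0<k<n),$$ $$\eta_{n,k}=\sum_{r=-1}^{n-k-1}(-2)^{r+2}\binom{k+n-r-3}{2k-2}H(k+n-r-2,r+2)\quad(n\ge k>0),$$ $$W^{(\mathrm{cl})}(X,Y)=\frac{1}{X(X+Y)(Y-X)}+\sum_{n>k>0}\gamma_{n,k}X^{n-k-1}Y^{2k-2},$$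 $$W^{(\mathrm{op})}(X,Y)=\frac{1}{X(X+Y)(Y-X)}+\sum_{n\ge k>0}\eta_{n,k}X^{n-k-1}Y^{2k-2}.$$ These series define germs of meromorphic functions at $(X,Y)=(0,0)$, and the identities are between such germs. *)

theory Defs
  imports "HOL-Analysis.Analysis"
begin

text \<open>Multiple zeta values with the convention \<open>0 < n\<^sub>1 < \<dots> < n\<^sub>m\<close>; the value at the empty index
  is 1. The terms are nonnegative, so the unordered sum is the usual one whenever the series
  converges (all entries positive, last entry at least 2); it is 0 by convention otherwise.\<close>

definition mzv :: "nat list \<Rightarrow> real" where
  "mzv ks = (\<Sum>\<^sub>\<infinity>ns \<in> {ns. length ns = length ks \<and> sorted_wrt (<) ns \<and> (\<forall>n\<in>set ns. 0 < n)}.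
               \<Prod>i<length ks. 1 / real (ns ! i) ^ (ks ! i))"

definition Z :: "nat \<Rightarrow> nat \<Rightarrow> real" where
  "Z k r = (\<Sum>rs \<in> {rs. set rs \<subseteq> {1, 2} \<and> sum_list rs = r}. 2 ^ count_list rs 1 * mzv (rs @ [k]))"

definition H :: "nat \<Rightarrow> nat \<Rightarrow> real" where
  "H k r = mzv (replicate (r - 1) 1 @ [k + 1])"

text \<open>In the ranges where the two coefficients below are used (\<open>0 < k < n\<close>, respectively
  \<open>0 < k \<le> n\<close>), none of the subtractions truncates.\<close>

definition gam :: "nat \<Rightarrow> nat \<Rightarrow> real" where
  "gam n k = (\<Sum>r = 0..n - k - 1.
     (-2) ^ (r + 2) * real ((n + k - r - 3) choose (2 * k - 2)) * Z (k + n - r) r)"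

text \<open>The summation index here is \<open>s = r + 2\<close>, where \<open>r\<close> runs from \<open>-1\<close> to \<open>n - k - 1\<close>.\<close>

definition eta :: "nat \<Rightarrow> nat \<Rightarrow> real" where
  "eta n k = (\<Sum>s = 1..n - k + 1.
     (-2) ^ s * real ((k + n - s - 1) choose (2 * k - 2)) * H (k + n - s) s)"

definition cl_index :: "(nat \<times> nat) set" where
  "cl_index = {(n, k). 0 < k \<and> k < n}"

definition op_index :: "(nat \<times> nat) set" where
  "op_index = {(n, k). 0 < k \<and> k \<le> n}"

definition cl_term :: "complex \<Rightarrow> complex \<Rightarrow> nat \<times> nat \<Rightarrow> complex" where
  "cl_term X Y = (\<lambda>(n, k). of_real (gam n k) * X ^ (n - k - 1) * Y ^ (2 * k - 2))"

text \<open>For \<open>n = k\<close> the exponent of \<open>X\<close> is \<open>-1\<close>, hence the integer power.\<close>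

definition op_term :: "complex \<Rightarrow> complex \<Rightarrow> nat \<times> nat \<Rightarrow> complex" where
  "op_term X Y = (\<lambda>(n, k). of_real (eta n k) * X powi (int n - int k - 1) * Y ^ (2 * k - 2))"

definition W_cl :: "complex \<Rightarrow> complex \<Rightarrow> complex" where
  "W_cl X Y = 1 / (X * (X + Y) * (Y - X)) + (\<Sum>\<^sub>\<infinity>p \<in> cl_index. cl_term X Y p)"

definition W_op :: "complex \<Rightarrow> complex \<Rightarrow> complex" where
  "W_op X Y = 1 / (X * (X + Y) * (Y - X)) + (\<Sum>\<^sub>\<infinity>p \<in> op_index. op_term X Y p)"

text \<open>Germs at the origin of \<open>\<complex>\<^sup>2\<close>. A meromorphic germ is a quotient of holomorphic germs with
  denominator not the zero germ. It is represented by a total function whose values on the zero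
  set of the denominator are irrelevant, so two representatives give the same germ if they agree
  near the origin off the zero set of a nonzero holomorphic germ.\<close>

definition holo_germ :: "(complex \<Rightarrow> complex \<Rightarrow> complex) \<Rightarrow> bool" where
  "holo_germ f \<longleftrightarrow> (\<exists>a :: nat \<Rightarrow> nat \<Rightarrow> complex.
     \<forall>\<^sub>F (x, y) in nhds (0, 0). ((\<lambda>(i, j). a i j * x ^ i * y ^ j) has_sum f x y) UNIV)"

definition nonzero_holo_germ :: "(complex \<Rightarrow> complex \<Rightarrow> complex) \<Rightarrow> bool" where
  "nonzero_holo_germ f \<longleftrightarrow> holo_germ f \<and> \<not> (\<forall>\<^sub>F (x, y) in nhds (0, 0). f x y = 0)"

definition mero_germ :: "(complex \<Rightarrow> complex \<Rightarrow> complex) \<Rightarrow> bool" where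
  "mero_germ f \<longleftrightarrow> (\<exists>g h. holo_germ g \<and> nonzero_holo_germ h \<and>
     (\<forall>\<^sub>F (x, y) in nhds (0, 0). h x y \<noteq> 0 \<longrightarrow> f x y = g x y / h x y))"

definition mero_germ_eq ::
  "(complex \<Rightarrow> complex \<Rightarrow> complex) \<Rightarrow> (complex \<Rightarrow> complex \<Rightarrow> complex) \<Rightarrow> bool" where
  "mero_germ_eq f g \<longleftrightarrow> (\<exists>h. nonzero_holo_germ h \<and>
     (\<forall>\<^sub>F (x, y) in nhds (0, 0). h x y \<noteq> 0 \<longrightarrow> f x y = g x y))"

end

theory Submission
  imports Defs
begin

text \<open>
  Put \<open>A = X + Y\<close>, \<open>B = X - Y\<close>. Resumming over all indices turns the coefficients of the two series
  into sums over the largest summation variable of the multiple zeta values: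
  \<open>W\<^sub>o\<^sub>p\<close> becomes a combination of \<open>\<Sum>\<^sub>n (\<Prod>\<^sub>m\<^sub><\<^sub>n (1 - 2X/m)) / (n (n - A))\<close> and the same sum for
  \<open>B\<close>, and \<open>W\<^sub>c\<^sub>l\<close> becomes \<open>\<Sum>\<^sub>n (\<Prod>\<^sub>m\<^sub><\<^sub>n (1 - 2X/m))\<^sup>2 (n - X) / (n\<^sup>2 (n - A) (n - B))\<close>.
  The former are Gauss sums \<open>\<^sub>2F\<^sub>1(-A, -2X; 1 - A; 1)\<close>, the latter is a very well-poised
  \<open>\<^sub>5F\<^sub>4\<close> at 1. Both are evaluated by the Wilf--Zeilberger method as quotients of Gamma values,
  after which both identities reduce to the reflection formula.
\<close>

section \<open>Two hypergeometric summations\<close>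

text \<open>The weight \<open>2 ^ count_list rs 1\<close> in \<open>Z\<close> explains the square in
  the closed case. Once the largest variable n is fixed, each m < n is absent, carries a part 1 or
  carries a part 2, and so contributes 1 + 2t/m + t^2/m^2 = (1 + t/m)^2; the powers of -2 and X give
  t = -2X. For \<open>H\<close> the factor is 1 + t/m. The binomial coefficients with even lower
  entry select (A^b + B^b)/2, and summing over b gives n/(n - A) and n/(n - B). The polar term
  1/(X(X+Y)(Y-X)) accounts for the term of index 0 in the hypergeometric series, so that Gamma
  quotients remain without an additive correction.

  The analytic obstacle is the rearrangement of sums over n, r, b and j. For |2X| <= 1/4 the product
  over m < n is at most sqrt n in norm, which leaves majorants of order n^(-3/2) and n^(-2). The
  same Pochhammer bounds, made uniform in the shift N, justify the limit in the Wilf--Zeilberger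
  argument. The identities are then proved pointwise off the three lines where the polar term is
  singular, which suffices for germs.\<close>

lemma pochhammer_ratio_tendsto_rGamma:
  fixes a b c a' b' c' :: complex
  assumes sum: "a + b + c = a' + b' + c'"
    and nz: "a' \<notin> \<int>\<^sub>\<le>\<^sub>0" "b' \<notin> \<int>\<^sub>\<le>\<^sub>0" "c' \<notin> \<int>\<^sub>\<le>\<^sub>0"
  shows "(\<lambda>N. pochhammer a N * pochhammer b N * pochhammer c N /
             (pochhammer a' N * pochhammer b' N * pochhammer c' N))
          \<longlonglongrightarrow> rGamma a * rGamma b * rGamma c / (rGamma a' * rGamma b' * rGamma c')"
proof -
  let ?R = "rGamma_series :: complex \<Rightarrow> nat \<Rightarrow> complex"
  have "(\<lambda>N. ?R a N * ?R b N * ?R c N / (?R a' N * ?R b' N * ?R c' N))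
      \<longlonglongrightarrow> rGamma a * rGamma b * rGamma c / (rGamma a' * rGamma b' * rGamma c')"
    using nz by (intro tendsto_intros) (auto simp: rGamma_eq_zero_iff)
  moreover have "?R a N * ?R b N * ?R c N / (?R a' N * ?R b' N * ?R c' N) =
      pochhammer a (Suc N) * pochhammer b (Suc N) * pochhammer c (Suc N) /
       (pochhammer a' (Suc N) * pochhammer b' (Suc N) * pochhammer c' (Suc N))" for N
  proof -
    let ?e = "\<lambda>z. exp (z * of_real (ln (of_nat N)))"
    \<comment> \<open>Each factor of Gauss's limit for 1/Gamma carries \<open>fact N\<close> and a
      power of \<open>N\<close> with exponent its parameter. There are three above and three below,
      and the powers cancel because the parameter sums agree.\<close>
    have "?e a * ?e b * ?e c = exp ((a + b + c) * of_real (ln (of_nat N)))"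
      by (simp add: exp_add[symmetric] algebra_simps)
    also have "\<dots> = ?e a' * ?e b' * ?e c'"
      by (simp only: sum) (simp add: exp_add[symmetric] algebra_simps)
    finally have e: "?e a * ?e b * ?e c = ?e a' * ?e b' * ?e c'" .
    have "?R a N * ?R b N * ?R c N = pochhammer a (Suc N) * pochhammer b (Suc N) * pochhammer c (Suc N) /
            (fact N ^ 3 * (?e a * ?e b * ?e c))"
      by (simp add: rGamma_series_def power3_eq_cube)
    moreover have "?R a' N * ?R b' N * ?R c' N = pochhammer a' (Suc N) * pochhammer b' (Suc N) * pochhammer c' (Suc N) /
            (fact N ^ 3 * (?e a' * ?e b' * ?e c'))"
      by (simp add: rGamma_series_def power3_eq_cube)
    ultimately show ?thesis unfolding e by simp
  qed
  ultimately show ?thesis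
    by (subst filterlim_sequentially_Suc [symmetric]) simp
qed

text \<open>\<open>g\<close> is the Wilf--Zeilberger certificate: summing \<open>rec\<close> over \<open>n\<close> gives a first-order recurrence
  in \<open>N\<close> for the row sums, whose limit as \<open>N\<close> tends to infinity is 1.\<close>

lemma wz_summation:
  fixes u g :: "nat \<Rightarrow> nat \<Rightarrow> complex"
  assumes rec: "\<And>N n. q N * u N n - p N * u (Suc N) n = g N (Suc n) - g N n"
    and p: "\<And>N. p N \<noteq> 0"
    and g0: "\<And>N. g N 0 = 0" and glim: "\<And>N. g N \<longlonglongrightarrow> 0"
    and u0: "\<And>N. u N 0 = 1"
    and bound: "\<And>N n. norm (u N (Suc n)) \<le> M n" and M: "summable M"
    and ulim: "\<And>n. (\<lambda>N. u N (Suc n)) \<longlonglongrightarrow> 0"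
    and L: "(\<lambda>N. \<Prod>k<N. q k / p k) \<longlonglongrightarrow> L"
  shows "summable (u 0)" "suminf (u 0) * L = 1"
proof -
  have sm': "summable (\<lambda>n. u N (Suc n))" for N
    by (rule summable_comparison_test'[OF M, of 0]) (use bound in auto)
  hence sm: "summable (u N)" for N by (simp add: summable_Suc_iff)
  then show "summable (u 0)" .
  have rec': "q N * suminf (u N) = p N * suminf (u (Suc N))" for N
  proof -
    have "(\<lambda>n. g N (Suc n) - g N n) sums (0 - g N 0)"
      by (rule telescope_sums[OF glim])
    moreover have "(\<lambda>n. q N * u N n - p N * u (Suc N) n) sums
        (q N * suminf (u N) - p N * suminf (u (Suc N)))"
      by (intro sums_diff sums_mult summable_sums sm)
    ultimately show ?thesis using rec g0 by (simp add: sums_iff)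
  qed
  have S: "suminf (u N) = suminf (u 0) * (\<Prod>k<N. q k / p k)" for N
  proof (induction N)
    case (Suc N)
    have "suminf (u (Suc N)) = (q N / p N) * suminf (u N)"
      using rec'[of N] p[of N] by (simp add: field_simps)
    then show ?case using Suc by simp
  qed simp
  \<comment> \<open>Tannery's theorem applies because the majorant \<open>M\<close> does not depend
    on \<open>N\<close>; every term except the one of index 0 dies out.\<close>
  have "(\<lambda>N. \<Sum>n. u N (Suc n)) \<longlonglongrightarrow> suminf (\<lambda>n. 0)"
    by (rule conjunct2[OF conjunct2[OF tannerys_theorem[OF ulim _ M]]])
       (use bound in \<open>auto intro!: always_eventually\<close>)
  hence "(\<lambda>N. u N 0 + (\<Sum>n. u N (Suc n))) \<longlonglongrightarrow> 1 + 0"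
    unfolding u0 by (intro tendsto_intros) simp
  moreover have "u N 0 + (\<Sum>n. u N (Suc n)) = suminf (u N)" for N
    using suminf_split_head[OF sm, of N] by simp
  ultimately have "(\<lambda>N. suminf (u N)) \<longlonglongrightarrow> 1" by simp
  moreover have "(\<lambda>N. suminf (u N)) \<longlonglongrightarrow> suminf (u 0) * L"
    by (subst S) (intro tendsto_intros L)
  ultimately show "suminf (u 0) * L = 1" using LIMSEQ_unique by blast
qed

section \<open>Bounds for Pochhammer quotients, uniform in the shift\<close>

lemma pochhammer_eq_0_imp_Re_nonpos:
  "pochhammer (z :: complex) n = 0 \<Longrightarrow> Re z \<le> 0"
  by (auto simp: pochhammer_eq_0_iff)

lemma norm_le_norm_add_of_nat:
  assumes "Re z \<ge> 0" shows "norm z \<le> norm (z + of_nat N)"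
proof -
  have "(Re z)\<^sup>2 \<le> (Re z + real N)\<^sup>2" using assms by (intro power_mono) auto
  then show ?thesis by (simp add: cmod_def)
qed

lemma norm_of_nat_add_ge: 
  assumes "norm (d :: complex) \<le> 1/4" shows "norm (of_nat N + d) \<ge> real N - 1/4"
  using norm_diff_ineq[of "of_nat N" d] assms by simp

lemma abs_Re_le_quarter:
  "norm (z :: complex) \<le> 1/4 \<Longrightarrow> \<bar>Re z\<bar> \<le> 1/4"
  using abs_Re_le_cmod[of z] by linarith

lemma sqrt_Suc_mult_le: "sqrt (real (Suc n)) * (1 + 1 / (4 * real (Suc n))) \<le> sqrt (real (Suc (Suc n)))"
proof (rule real_le_rsqrt)
  define t where "t = real (Suc n)"
  have t: "t \<ge> 1" by (simp add: t_def)
  have "(sqrt t * (1 + 1 / (4*t)))\<^sup>2 = t * (1 + 1/(4*t))\<^sup>2"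
    using t by (simp add: power_mult_distrib)
  also have "\<dots> = t + 1/2 + 1/(16*t)" using t by (simp add: power2_eq_square field_simps)
  also have "\<dots> \<le> t + 1" using t by (simp add: field_simps)
  finally show "(sqrt (real (Suc n)) * (1 + 1 / (4 * real (Suc n))))\<^sup>2 \<le> real (Suc (Suc n))"
    by (simp add: t_def)
qed

text \<open>A new factor has norm at most 1 + 1/(4(n+1)), so the true growth is at most of order
  n^(1/4). The cruder square root passes through the induction, and two such bounds multiply to n +
  1.\<close>

lemma norm_pochhammer_ratio_le_sqrt:
  assumes d: "norm (d :: complex) \<le> 1/4"
  shows "norm (pochhammer (of_nat (Suc N) + d) n / pochhammer (of_nat (Suc N)) n) \<le> sqrt (real (Suc n))"
proof (induction n)
  case (Suc n)
  have "norm ((of_nat (Suc N) + d + of_nat n) / (of_nat (Suc N) + of_nat n)) =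
      norm (1 + d / of_nat (Suc N + n))"
    by (simp add: field_simps del: of_nat_Suc flip: of_nat_add) 
  also have "\<dots> \<le> 1 + norm d / real (Suc N + n)"
    using norm_triangle_ineq[of 1 "d / of_nat (Suc N + n)"] by (simp add: norm_divide del: of_nat_Suc of_nat_add)
  also have "\<dots> \<le> 1 + (1/4) / real (Suc n)" using d by (intro add_left_mono frac_le) auto
  finally have *: "norm ((of_nat (Suc N) + d + of_nat n) / (of_nat (Suc N) + of_nat n)) \<le> 1 + 1 / (4 * real (Suc n))"
    by simp
  have "norm (pochhammer (of_nat (Suc N) + d) (Suc n) / pochhammer (of_nat (Suc N)) (Suc n)) =
     norm (pochhammer (of_nat (Suc N) + d) n / pochhammer (of_nat (Suc N)) n) *
     norm ((of_nat (Suc N) + d + of_nat n) / (of_nat (Suc N) + of_nat n))"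
    by (simp add: pochhammer_Suc norm_mult norm_divide del: of_nat_Suc)
  also have "\<dots> \<le> sqrt (real (Suc n)) * (1 + 1 / (4 * real (Suc n)))"
    by (intro mult_mono Suc.IH *) auto
  also have "\<dots> \<le> sqrt (real (Suc (Suc n)))" by (rule sqrt_Suc_mult_le)
  finally show ?case .
qed simp

lemma norm_pochhammer_fact_le:
  assumes d: "norm (d :: complex) \<le> 1/4"
  shows "norm (pochhammer d (Suc n) / fact (Suc n)) \<le> sqrt (real (Suc n)) / real (Suc n)"
proof -
  have one: "of_nat (Suc 0) = (1 :: complex)" by simp
  have "norm (pochhammer d (Suc n) / fact (Suc n)) =
      norm d / real (Suc n) * norm (pochhammer (of_nat (Suc 0) + d) n / pochhammer (of_nat (Suc 0)) n)"
    unfolding pochhammer_rec fact_Suc one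
    by (simp add: norm_mult norm_divide add.commute pochhammer_fact norm_fact del: of_nat_Suc)
  also have "\<dots> \<le> 1 / real (Suc n) * sqrt (real (Suc n))"
    using d by (intro mult_mono norm_pochhammer_ratio_le_sqrt divide_right_mono) auto
  finally show ?thesis by simp
qed

text \<open>The numerator is \<open>b\<close> times \<open>pochhammer (b + 1) n\<close>. Its factors
  have positive real part, so adding \<open>N\<close> to each of them only increases the norm. What
  remains is \<open>norm b\<close> over the last factor of the denominator, which is at least N + n
  + 1 - 1/4.\<close>

lemma norm_pochhammer_shift_ratio_le:
  assumes b: "norm (b :: complex) \<le> 1/4"
  shows "norm (pochhammer b (Suc n) / pochhammer (of_nat (Suc N) + b) (Suc n)) \<le> 1 / real (N + n + 1)"
proof -
  have Re: "Re b \<ge> -1/4" using abs_Re_le_quarter[OF b] by linarith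
  have nz: "pochhammer (of_nat (Suc N) + b) n \<noteq> 0" for N n
    using pochhammer_eq_0_imp_Re_nonpos[of "of_nat (Suc N) + b" n] Re by auto
  have le: "norm (pochhammer (b + 1) n) \<le> norm (pochhammer (of_nat (Suc N) + b) n)"
    unfolding pochhammer_prod prod_norm[symmetric]
  proof (intro prod_mono conjI norm_ge_zero)
    fix i
    have "norm (b + 1 + of_nat i) \<le> norm (b + 1 + of_nat i + of_nat N)"
      using Re by (intro norm_le_norm_add_of_nat) auto
    then show "norm (b + 1 + of_nat i) \<le> norm (of_nat (Suc N) + b + of_nat i)"
      by (simp add: algebra_simps)
  qed
  have ge: "real (N + n + 1) - 1/4 \<le> norm (of_nat (Suc N) + b + of_nat n)"
    using norm_of_nat_add_ge[OF b, of "N+n+1"] by (simp add: algebra_simps)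
  have "norm (pochhammer b (Suc n) / pochhammer (of_nat (Suc N) + b) (Suc n)) =
      (norm b / norm (of_nat (Suc N) + b + of_nat n)) * (norm (pochhammer (b+1) n) / norm (pochhammer (of_nat (Suc N) + b) n))"
    by (subst pochhammer_rec, subst pochhammer_Suc) (simp add: norm_mult norm_divide)
  also have "\<dots> \<le> ((1/4) / (real (N + n + 1) - 1/4)) * 1"
    using le nz[of N n] b ge by (intro mult_mono frac_le) (auto simp: field_simps)
  also have "\<dots> \<le> 1 / real (N + n + 1)" by (simp add: field_simps)
  finally show ?thesis .
qed

lemma Re_pos_not_nonpos_Int: "Re z > 0 \<Longrightarrow> z \<notin> \<int>\<^sub>\<le>\<^sub>0"
  by (auto elim!: nonpos_Ints_cases)

lemma summable_sqrt_over_square: "summable (\<lambda>n. sqrt (real (Suc n)) / real (Suc n) ^ 2)"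
proof -
  have "summable (\<lambda>n. real n powr (-3/2))" by (subst summable_real_powr_iff) simp
  hence "summable (\<lambda>n. real (Suc n) powr (-3/2))" by (subst (asm) summable_Suc_iff[symmetric])
  also have "(\<lambda>n. real (Suc n) powr (-3/2)) = (\<lambda>n. sqrt (real (Suc n)) / real (Suc n) ^ 2)"
  proof
    fix n
    have "real (Suc n) powr (-3/2) = real (Suc n) powr (1/2 - 2)" by simp
    also have "\<dots> = real (Suc n) powr (1/2) / real (Suc n) powr 2" by (rule powr_diff)
    also have "\<dots> = sqrt (real (Suc n)) / real (Suc n) ^ 2"
      by (simp only: powr_half_sqrt of_nat_0_le_iff) (simp flip: powr_numeral)
    finally show "real (Suc n) powr (-3/2) = sqrt (real (Suc n)) / real (Suc n) ^ 2" .
  qed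
  finally show ?thesis .
qed

text \<open>Gauss's theorem for 2F1(a, b; c; 1) with a = -x, b = y, c = 1 - x. The rows
  \<open>U N\<close> raise c by \<open>N\<close>, and \<open>q\<close>, \<open>p\<close> come from
  the contiguous relation c(c-a-b) F(c) = (c-a)(c-b) F(c+1).\<close>

lemma gauss_summation_special:
  fixes x y :: complex
  assumes x: "norm x \<le> 1/4" and y: "norm y \<le> 1/4"
  defines "u \<equiv> \<lambda>n. pochhammer (- x) n * pochhammer y n / (fact n * pochhammer (1 - x) n)"
  shows "summable u"
    and "suminf u * (rGamma (1 - x) * rGamma (1 - y)) = rGamma (1 - x - y)"
proof -
  define U :: "nat \<Rightarrow> nat \<Rightarrow> complex" where
    "U = (\<lambda>N n. pochhammer (- x) n * pochhammer y n / (fact n * pochhammer (of_nat (Suc N) - x) n))"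
  define q where "q = (\<lambda>N. (of_nat (Suc N) - x) * (of_nat (Suc N) - y))"
  define p where "p = (\<lambda>N. (of_nat (Suc N)) * (of_nat (Suc N) - x - y))"
  define g where "g = (\<lambda>N n. - (of_nat (Suc N) - x) * of_nat n * U N n)"
  have Re: "\<bar>Re x\<bar> \<le> 1/4" "\<bar>Re y\<bar> \<le> 1/4" using x y abs_Re_le_quarter by blast+
  have nz: "of_nat (Suc N) - x + of_nat n \<noteq> 0" for N n
  proof
    assume "of_nat (Suc N) - x + of_nat n = 0"
    hence "Re (of_nat (Suc N) - x + of_nat n) = 0" by simp
    thus False using Re by simp
  qed
  have nz2: "of_nat (Suc N) - x - y \<noteq> 0" for N
  proof
    assume "of_nat (Suc N) - x - y = 0"
    hence "Re (of_nat (Suc N) - x - y) = 0" by simp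
    thus False using Re by simp
  qed
  have pnz: "pochhammer (of_nat (Suc N) - x) n \<noteq> 0" for N n
    using pochhammer_eq_0_imp_Re_nonpos[of "of_nat (Suc N) - x" n] Re by auto
  \<comment> \<open>The bound decays in both indices: in \<open>n\<close> fast enough for a summable
    majorant, and in \<open>N\<close> so that each term of positive index tends to 0.\<close>
  have bound: "norm (U N (Suc n)) \<le> 1 / real (N + n + 1) * (sqrt (real (Suc n)) / real (Suc n))" for N n
  proof -
    have "U N (Suc n) = (pochhammer (-x) (Suc n) / pochhammer (of_nat (Suc N) + (-x)) (Suc n)) * (pochhammer y (Suc n) / fact (Suc n))"
      by (simp add: U_def)
    also have "norm \<dots> \<le> 1 / real (N + n + 1) * (sqrt (real (Suc n)) / real (Suc n))"
      unfolding norm_mult using x y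
      by (intro mult_mono norm_pochhammer_shift_ratio_le norm_pochhammer_fact_le) auto
    finally show ?thesis .
  qed
  have bound': "norm (U N (Suc n)) \<le> sqrt (real (Suc n)) / real (Suc n) ^ 2" for N n
  proof -
    have "1 / real (N + n + 1) * (sqrt (real (Suc n)) / real (Suc n)) \<le>
          1 / real (Suc n) * (sqrt (real (Suc n)) / real (Suc n))"
      by (intro mult_right_mono frac_le) auto
    also have "\<dots> = sqrt (real (Suc n)) / real (Suc n) ^ 2" by (simp add: power2_eq_square)
    finally show ?thesis using bound[of N n] by linarith
  qed
  have USuc: "U N (Suc n) = U N n * ((of_nat n - x) * (y + of_nat n) / (of_nat (Suc n) * (of_nat (Suc N) - x + of_nat n)))" for N n
    by (simp add: U_def pochhammer_Suc fact_Suc algebra_simps del: of_nat_Suc)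
  have shift: "U (Suc N) n = U N n * ((of_nat (Suc N) - x) / (of_nat (Suc N) - x + of_nat n))" for N n
  proof -
    have "pochhammer (of_nat (Suc N) - x) (Suc n) = (of_nat (Suc N) - x) * pochhammer (of_nat (Suc (Suc N)) - x) n"
      by (simp add: pochhammer_rec algebra_simps)
    hence "(of_nat (Suc N) - x) * pochhammer (of_nat (Suc (Suc N)) - x) n = pochhammer (of_nat (Suc N) - x) n * (of_nat (Suc N) - x + of_nat n)"
      by (simp add: pochhammer_Suc)
    then show ?thesis
      using nz[of N n] pnz[of N n] pnz[of "Suc N" n]
      unfolding U_def by (simp add: divide_simps del: of_nat_Suc)
  qed
  \<comment> \<open>By \<open>USuc\<close> and \<open>shift\<close>, all four terms are rational
    multiples of \<open>U N n\<close>, so the recurrence reduces to a polynomial identity in c, x, y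
    and n.\<close>
  have rec: "q N * U N n - p N * U (Suc N) n = g N (Suc n) - g N n" for N n
  proof -
    define c where "c = of_nat (Suc N) - x"
    have c: "c + of_nat n \<noteq> 0" using nz by (simp add: c_def)
    have cN: "of_nat (Suc N) = c + x" by (simp add: c_def)
    have n1: "(1 + of_nat n :: complex) \<noteq> 0" by (metis of_nat_Suc of_nat_eq_0_iff nat.distinct(1))
    show ?thesis
      unfolding g_def USuc shift q_def p_def cN
      using c n1 by (simp add: divide_simps) algebra
  qed
  have glim: "g N \<longlonglongrightarrow> 0" for N
  proof (subst filterlim_sequentially_Suc[symmetric], rule Lim_null_comparison)
    have "norm (g N (Suc n)) \<le> norm (of_nat (Suc N) - x) * (sqrt (real (Suc n)) / real (Suc n))" for n
    proof -
      have "norm (g N (Suc n)) = norm (of_nat (Suc N) - x) * (real (Suc n) * norm (U N (Suc n)))"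
        by (simp add: g_def norm_mult norm_minus_commute del: of_nat_Suc)
      also have "\<dots> \<le> norm (of_nat (Suc N) - x) * (real (Suc n) * (sqrt (real (Suc n)) / real (Suc n) ^ 2))"
        by (intro mult_left_mono bound') auto
      finally show ?thesis by (simp add: power2_eq_square)
    qed
    then show "\<forall>\<^sub>F n in sequentially. norm (g N (Suc n)) \<le> norm (of_nat (Suc N) - x) * (sqrt (real (Suc n)) / real (Suc n))"
      by simp
    have "(\<lambda>n. 1 / sqrt (real (Suc n))) \<longlonglongrightarrow> 0"
      by (intro real_tendsto_divide_at_top[OF tendsto_const] filterlim_compose[OF sqrt_at_top] filterlim_compose[OF filterlim_real_sequentially filterlim_Suc])
    hence "(\<lambda>n. sqrt (real (Suc n)) / real (Suc n)) \<longlonglongrightarrow> 0"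
      by (simp add: sqrt_divide_self_eq inverse_eq_divide)
    then show "(\<lambda>n. norm (of_nat (Suc N) - x) * (sqrt (real (Suc n)) / real (Suc n))) \<longlonglongrightarrow> 0"
      by (rule tendsto_mult_right_zero)
  qed
  have ulim: "(\<lambda>N. U N (Suc n)) \<longlonglongrightarrow> 0" for n
  proof (rule Lim_null_comparison)
    show "\<forall>\<^sub>F N in sequentially. norm (U N (Suc n)) \<le> 1 / real (N + n + 1) * (sqrt (real (Suc n)) / real (Suc n))"
      using bound by simp
    have "(\<lambda>N. 1 / real (N + Suc n)) \<longlonglongrightarrow> 0"
      using LIMSEQ_ignore_initial_segment[OF lim_1_over_n, of "Suc n"] by simp
    thus "(\<lambda>N. 1 / real (N + n + 1) * (sqrt (real (Suc n)) / real (Suc n))) \<longlonglongrightarrow> 0"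
      by (intro tendsto_mult_left_zero) simp
  qed
  have L: "(\<lambda>N. \<Prod>k<N. q k / p k) \<longlonglongrightarrow> rGamma (1 - x) * rGamma (1 - y) * rGamma 1 / (rGamma 1 * rGamma (1 - x - y) * rGamma 1)"
  proof -
    \<comment> \<open>One factor \<open>pochhammer 1 N\<close> above and one below are padding,
      since the limit lemma takes three factors on each side.\<close>
    have eq: "(\<Prod>k<N. q k / p k) = pochhammer (1-x) N * pochhammer (1-y) N * pochhammer 1 N / (pochhammer 1 N * pochhammer (1-x-y) N * pochhammer 1 N)" for N
    proof -
      have "pochhammer (1::complex) N \<noteq> 0" by (simp add: pochhammer_fact[symmetric])
      moreover have "(\<Prod>k<N. q k / p k) = pochhammer (1-x) N * pochhammer (1-y) N / (pochhammer 1 N * pochhammer (1-x-y) N)"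
        by (simp add: q_def p_def pochhammer_prod atLeast0LessThan diff_add_eq[symmetric] add.commute
                 flip: prod_dividef prod.distrib) (simp add: algebra_simps)
      ultimately show ?thesis by simp
    qed
    show ?thesis unfolding eq
      using Re by (intro pochhammer_ratio_tendsto_rGamma Re_pos_not_nonpos_Int) auto
  qed
  have u: "u = U 0" by (simp add: U_def u_def fun_eq_iff)
  note wz = wz_summation[OF rec _ _ glim _ bound' summable_sqrt_over_square ulim L]
  have p0: "p N \<noteq> 0" for N unfolding p_def using nz2[of N] by (simp del: of_nat_Suc)
  show "summable u" unfolding u by (rule wz) (use p0 in \<open>auto simp: g_def U_def\<close>)
  have "suminf u * (rGamma (1 - x) * rGamma (1 - y) * rGamma 1 / (rGamma 1 * rGamma (1 - x - y) * rGamma 1)) = 1"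
    unfolding u by (rule wz) (use p0 in \<open>auto simp: g_def U_def\<close>)
  moreover have "rGamma (1 - x - y) \<noteq> 0" using Re_pos_not_nonpos_Int[of "1-x-y"] Re by (simp add: rGamma_eq_zero_iff)
  ultimately show "suminf u * (rGamma (1 - x) * rGamma (1 - y)) = rGamma (1 - x - y)"
    by (simp add: divide_simps rGamma_eq_zero_iff split: if_splits)
qed

text \<open>This is the summation of the very well-poised \<open>\<^sub>5F\<^sub>4(a, 1 + a/2, b, c, d; \<dots>; 1)\<close> for
  \<open>a = d = b + c\<close>; the recurrence shifts \<open>a\<close> to \<open>a + N\<close> and leaves \<open>b\<close>, \<open>c\<close>, \<open>d\<close> fixed.\<close>

lemma well_poised_summation_special:
  fixes b c d :: complex
  assumes b: "norm b \<le> 1/4" and c: "norm c \<le> 1/4" and d: "norm d \<le> 1/4" and dbc: "d = b + c"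
    and d0: "d \<noteq> 0"
  defines "u \<equiv> \<lambda>n. (d + 2 * of_nat n) * pochhammer d n / d * pochhammer b n * pochhammer c n * pochhammer d n /
             (fact n * fact n * pochhammer (1 + b) n * pochhammer (1 + c) n)"
  shows "summable u"
    and "suminf u * (rGamma (1 + b) * rGamma (1 + c) * rGamma (1 - d)) =
           rGamma (1 + d) * rGamma (1 - b) * rGamma (1 - c)"
proof -
  \<comment> \<open>With a = N + d, the very well-poised factor a + 2n is kept out of
    \<open>V\<close>, so that the ratios of \<open>V\<close> in \<open>n\<close> and in
    \<open>N\<close> are quotients of linear factors. The lower parameters 1 + a - d, 1 + a - c, 1 +
    a - b become N + 1, N + 1 + b, N + 1 + c because d = b + c. The division by a at
    \<open>N = 0\<close> uses \<open>d0\<close>.\<close>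
  define V :: "nat \<Rightarrow> nat \<Rightarrow> complex" where
    "V = (\<lambda>N n. pochhammer (of_nat N + d) n / (of_nat N + d) * pochhammer b n * pochhammer c n * pochhammer d n /
           (fact n * pochhammer (of_nat (Suc N)) n * pochhammer (of_nat (Suc N) + b) n * pochhammer (of_nat (Suc N) + c) n))"
  define U where "U = (\<lambda>N n. (of_nat N + d + 2 * of_nat n) * V N n)"
  \<comment> \<open>\<open>q N / p N\<close> is the factor by which the expected Gamma quotient
    changes when a = N + d is raised by 1.\<close>
  define q where "q = (\<lambda>N. (of_nat (Suc N) + b) * (of_nat (Suc N) + c) * (of_nat (Suc N) - d))"
  define p where "p = (\<lambda>N. (of_nat (Suc N) + d) * (of_nat (Suc N) - b) * (of_nat (Suc N) - c))"
  define g where "g = (\<lambda>N n. - ((of_nat (Suc N) + b) * (of_nat (Suc N) + c) * of_nat n * of_nat (n + 2 * N + 1) * V N n))"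
  have Re: "\<bar>Re b\<bar> \<le> 1/4" "\<bar>Re c\<bar> \<le> 1/4" "\<bar>Re d\<bar> \<le> 1/4" using b c d abs_Re_le_quarter by blast+
  have Suc_nz: "of_nat (Suc N) + z \<noteq> 0" if "\<bar>Re z\<bar> \<le> 1/4" for N z
  proof
    assume "of_nat (Suc N) + z = 0"
    hence "Re (of_nat (Suc N) + z) = 0" by simp
    thus False using that by simp
  qed
  have nz: "of_nat (Suc N) + z + of_nat n \<noteq> 0" if "\<bar>Re z\<bar> \<le> 1/4" for N n z
    using Suc_nz[of z "N+n"] that by (simp add: algebra_simps)
  have nz0: "of_nat N + d \<noteq> 0" for N
    using d0 Suc_nz[of d "N - 1"] Re by (cases N) (auto simp: algebra_simps)
  have pnz: "pochhammer (of_nat (Suc N) + z) n \<noteq> 0" if "\<bar>Re z\<bar> \<le> 1/4" for N n z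
    using pochhammer_eq_0_imp_Re_nonpos[of "of_nat (Suc N) + z" n] that by auto
  have pnz1: "pochhammer (of_nat (Suc N) :: complex) n \<noteq> 0" for N n
    using pnz[of 0] by simp
  have VSuc: "V N (Suc n) = V N n * ((of_nat N + d + of_nat n) * (b + of_nat n) * (c + of_nat n) * (d + of_nat n) /
      (of_nat (Suc n) * (of_nat (Suc N) + of_nat n) * (of_nat (Suc N) + b + of_nat n) * (of_nat (Suc N) + c + of_nat n)))" for N n
    by (simp add: V_def pochhammer_Suc fact_Suc mult_ac del: of_nat_Suc)
  have pshift: "pochhammer (of_nat (Suc N) + z) n = pochhammer (of_nat N + z) n * (of_nat N + z + of_nat n) / (of_nat N + z)"
    if "of_nat N + z \<noteq> 0" for N n and z :: complex
  proof -
    have "pochhammer (of_nat N + z) (Suc n) = (of_nat N + z) * pochhammer (of_nat (Suc N) + z) n"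
      by (simp add: pochhammer_rec algebra_simps)
    then show ?thesis using that by (simp add: pochhammer_Suc field_simps)
  qed
  have VS: "V (Suc N) n = V N n * ((of_nat N + d + of_nat n) / (of_nat (Suc N) + d) *
     of_nat (Suc N) / (of_nat (Suc N) + of_nat n) * (of_nat (Suc N) + b) / (of_nat (Suc N) + b + of_nat n)
      * (of_nat (Suc N) + c) / (of_nat (Suc N) + c + of_nat n))" for N n
    unfolding V_def 
    using pshift[of N d n] pshift[of "Suc N" b n] pshift[of "Suc N" c n] pshift[of "Suc N" 0 n]
      nz0[of N] Suc_nz[of b N] Suc_nz[of c N] Re nz[of b N n] nz[of c N n] nz[of 0 N n] pnz1[of N n] pnz[of b N n] pnz[of c N n]
    by (simp del: of_nat_Suc) (simp only: mult_ac)
  have rec: "q N * U N n - p N * U (Suc N) n = g N (Suc n) - g N n" for N n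
  proof -
    define M :: complex where "M = of_nat (Suc N)"
    define m :: complex where "m = of_nat n"
    have N: "of_nat N = M - 1" by (simp add: M_def)
    have eqs: "of_nat (Suc N) = M" "of_nat n = m" "of_nat (Suc n) = m + 1" "of_nat (n + 2 * N + 1) = m + 2 * M - 1"
       "of_nat (Suc n + 2 * N + 1) = m + 2 * M"
      by (simp_all add: M_def m_def)
    have n: "m + 1 \<noteq> 0" "M + d \<noteq> 0" "M + m \<noteq> 0" "M + b + m \<noteq> 0" "M + c + m \<noteq> 0"
      using Suc_nz[of 0 n] Suc_nz[of d N] nz[of 0 N n] nz[of b N n] nz[of c N n] Re
      by (auto simp: M_def m_def algebra_simps)
    let ?D = "(M + m) * (M + b + m) * (M + c + m)"
    \<comment> \<open>\<open>aux1\<close> and \<open>aux2\<close> clear denominators with opaque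
      letters, which leaves the polynomial identity \<open>key\<close>; that identity is where d = b
      + c enters.\<close>
    have aux1: "e * f * (h * W) - k * (W * r * e / D) = W * e / D * (f * h * D - k * r)"
      if "D \<noteq> 0" for D e f h W k r :: complex
      using that by (simp add: field_simps)
    have aux2: "W * e / D * (- s * T + l * t * D) = - e * s * (W * T / D) + e * l * t * W"
      if "D \<noteq> 0" for D W e s T l t :: complex
      using that by (simp add: field_simps)
    have D: "?D \<noteq> 0" using n by simp
    have k1: "(M + d) * (V N n * ((M - 1 + d + m) / (M + d) * M / (M + m) * (M + b) / (M + b + m) * (M + c) / (M + c + m)))
        = V N n * (M - 1 + d + m) * M * (M + b) * (M + c) / ?D" using n by (simp add: mult_ac)
    have k2: "(m + 1) * (V N n * ((M - 1 + d + m) * (b + m) * (c + m) * (d + m) / ((m + 1) * (M + m) * (M + b + m) * (M + c + m))))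
        = V N n * ((M - 1 + d + m) * (b + m) * (c + m) * (d + m)) / ?D" using n by (simp add: mult_ac)
    have key: "(M - d) * (M - 1 + d + 2 * m) * ?D - (M - b) * (M - c) * (M + d + 2 * m) * ((M - 1 + d + m) * M) =
       - (m + 2 * M) * ((M - 1 + d + m) * (b + m) * (c + m) * (d + m)) + m * (m + 2 * M - 1) * ?D"
      unfolding dbc by algebra
    have "q N * U N n - p N * U (Suc N) n =
      (M + b) * (M + c) * (M - d) * ((M - 1 + d + 2 * m) * V N n) -
      (M - b) * (M - c) * (M + d + 2 * m) * ((M + d) * (V N n * ((M - 1 + d + m) / (M + d) * M / (M + m) * (M + b) / (M + b + m) * (M + c) / (M + c + m))))"
      unfolding q_def p_def U_def VS eqs N by (simp add: mult_ac)
    also have "\<dots> = V N n * (M + b) * (M + c) / ?D * ((M - d) * (M - 1 + d + 2 * m) * ?D - (M - b) * (M - c) * (M + d + 2 * m) * ((M - 1 + d + m) * M))"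
      unfolding k1 using aux1[OF D, of "(M + b) * (M + c)" "M - d" "M - 1 + d + 2 * m" "V N n"
        "(M - b) * (M - c) * (M + d + 2 * m)" "(M - 1 + d + m) * M"] by (simp only: mult_ac)
    also have "\<dots> = V N n * (M + b) * (M + c) / ?D * (- (m + 2 * M) * ((M - 1 + d + m) * (b + m) * (c + m) * (d + m)) + m * (m + 2 * M - 1) * ?D)"
      unfolding key ..
    also have "\<dots> = - ((M + b) * (M + c)) * (m + 2 * M) * (V N n * ((M - 1 + d + m) * (b + m) * (c + m) * (d + m)) / ?D)
       + (M + b) * (M + c) * m * (m + 2 * M - 1) * V N n"
      using aux2[OF D, of "V N n" "(M + b) * (M + c)" "m + 2 * M" "(M - 1 + d + m) * (b + m) * (c + m) * (d + m)"
        m "m + 2 * M - 1"] by (simp only: mult_ac)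
    also have "\<dots> = g N (Suc n) - g N n"
      unfolding g_def VSuc eqs N k2[symmetric] using n by (simp add: mult_ac)
    finally show ?thesis .
  qed
  \<comment> \<open>Of the four quotients, two contribute 1/(N+n+1) each, and the other two
    contribute square roots whose product cancels the denominator n + 1. Hence \<open>V\<close> is
    of order (N+n+1)^(-3).\<close>
  have bound0: "norm (V N (Suc n)) * real (N + n + 1) \<le> 1 / real (N + n + 1) ^ 2" for N n
  proof -
    have "pochhammer (of_nat N + d) (Suc n) / (of_nat N + d) = pochhammer (of_nat (Suc N) + d) n"
      using nz0[of N] by (simp add: pochhammer_rec add_ac)
    hence "V N (Suc n) * of_nat (N + n + 1) =
       (pochhammer b (Suc n) / pochhammer (of_nat (Suc N) + b) (Suc n)) *
       (pochhammer c (Suc n) / pochhammer (of_nat (Suc N) + c) (Suc n)) *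
       (pochhammer (of_nat (Suc N) + d) n / pochhammer (of_nat (Suc N)) n) *
       (pochhammer d (Suc n) / fact (Suc n))"
      using nz[of 0 N n] 
      unfolding V_def pochhammer_Suc[of "of_nat (Suc N)" n]
      by (simp add: add_ac del: of_nat_Suc) (simp add: add_ac mult_ac)
    hence "norm (V N (Suc n)) * real (N + n + 1) = norm ((pochhammer b (Suc n) / pochhammer (of_nat (Suc N) + b) (Suc n)) *
       (pochhammer c (Suc n) / pochhammer (of_nat (Suc N) + c) (Suc n)) *
       (pochhammer (of_nat (Suc N) + d) n / pochhammer (of_nat (Suc N)) n) *
       (pochhammer d (Suc n) / fact (Suc n)))"
      by (metis norm_mult norm_of_nat)
    also have "\<dots> \<le> (1 / real (N + n + 1)) * (1 / real (N + n + 1)) * sqrt (real (Suc n)) * (sqrt (real (Suc n)) / real (Suc n))"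
      unfolding norm_mult
      by (intro mult_mono norm_pochhammer_shift_ratio_le norm_pochhammer_fact_le norm_pochhammer_ratio_le_sqrt b c d) auto
    also have "\<dots> = 1 / real (N + n + 1) ^ 2 * (sqrt (real (Suc n)) * sqrt (real (Suc n)) / real (Suc n))"
      by (simp only: power2_eq_square times_divide_eq_right times_divide_eq_left divide_divide_eq_left mult_1 mult_1_right mult_ac)
    also have "sqrt (real (Suc n)) * sqrt (real (Suc n)) / real (Suc n) = 1"
      by simp
    finally show ?thesis by simp
  qed
  have boundN: "norm (U N (Suc n)) \<le> 3 / real (N + n + 1) ^ 2" for N n
  proof -
    have "norm (of_nat N + d + 2 * of_nat (Suc n)) = norm (of_nat (N + 2 * Suc n) + d)" by (simp add: algebra_simps)
    also have "\<dots> \<le> real (N + 2 * Suc n) + 1 / 4"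
      using norm_triangle_ineq[of "of_nat (N + 2 * Suc n)" d] d unfolding norm_of_nat by linarith
    also have "\<dots> \<le> 3 * real (N + n + 1)" by simp
    finally have "norm (U N (Suc n)) \<le> 3 * real (N + n + 1) * norm (V N (Suc n))"
      unfolding U_def norm_mult by (rule mult_right_mono) simp
    also have "\<dots> \<le> 3 * (1 / real (N + n + 1) ^ 2)"
      using mult_left_mono[OF bound0[of N n], of 3] by (simp only: mult_ac)
    finally show ?thesis by simp
  qed
  have bound: "norm (U N (Suc n)) \<le> 3 / real (Suc n) ^ 2" for N n
  proof -
    have "3 / real (N + n + 1) ^ 2 \<le> 3 / real (Suc n) ^ 2"
      by (intro divide_left_mono power_mono) auto
    with boundN[of N n] show ?thesis by linarith
  qed
  have M: "summable (\<lambda>n. 3 / real (Suc n) ^ 2)"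
    using summable_mult[OF inverse_power_summable[of 2, where 'a = real], of 3]
    by (subst summable_Suc_iff) (simp add: field_simps)
  have lim1: "(\<lambda>N. 1 / real (N + Suc n)) \<longlonglongrightarrow> 0" for n
    using LIMSEQ_ignore_initial_segment[OF lim_1_over_n, of "Suc n"] by simp
  have ulim: "(\<lambda>N. U N (Suc n)) \<longlonglongrightarrow> 0" for n
  proof (rule Lim_null_comparison)
    show "\<forall>\<^sub>F N in sequentially. norm (U N (Suc n)) \<le> 3 * (1 / real (N + Suc n)) ^ 2"
      using boundN by (simp add: power_divide)
    show "(\<lambda>N. 3 * (1 / real (N + Suc n)) ^ 2) \<longlonglongrightarrow> 0"
      using tendsto_mult[OF tendsto_const[of 3] tendsto_power[OF lim1[of n], of 2]] by simp
  qed
  \<comment> \<open>The factor in \<open>g\<close> is quadratic in \<open>n\<close> while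
    \<open>V\<close> decays like n^(-3), so 1/n is left over.\<close>
  have glim: "g N \<longlonglongrightarrow> 0" for N
  proof (subst filterlim_sequentially_Suc[symmetric], rule Lim_null_comparison)
    define K where "K = norm ((of_nat (Suc N) + b) * (of_nat (Suc N) + c))"
    have "norm (g N (Suc n)) \<le> K * (2 * (1 / real (n + Suc N)))" for n
    proof -
      have "norm (g N (Suc n)) = K * (real (Suc n) * real (Suc n + 2 * N + 1) * norm (V N (Suc n)))"
        unfolding g_def K_def norm_mult norm_minus_cancel norm_of_nat by (simp add: mult_ac)
      also have "\<dots> \<le> K * (real (N + n + 1) * (2 * real (N + n + 1)) * norm (V N (Suc n)))"
        unfolding K_def by (intro mult_left_mono mult_right_mono mult_mono) auto
      also have "\<dots> = K * (2 * real (N + n + 1) * (norm (V N (Suc n)) * real (N + n + 1)))"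
        by simp
      also have "\<dots> \<le> K * (2 * real (N + n + 1) * (1 / real (N + n + 1) ^ 2))"
        unfolding K_def by (intro mult_left_mono bound0) auto
      also have "\<dots> = K * (2 * (1 / real (n + Suc N)))"
      proof -
        have "n + Suc N = N + n + 1" by simp
        moreover have "K * (2 * r * (1 / r ^ 2)) = K * (2 * (1 / r))" if "r \<noteq> 0" for r :: real
          using that by (simp add: power2_eq_square)
        ultimately show ?thesis by (metis of_nat_eq_0_iff add_is_0 one_neq_zero)
      qed
      finally show ?thesis .
    qed
    then show "\<forall>\<^sub>F n in sequentially. norm (g N (Suc n)) \<le> K * (2 * (1 / real (n + Suc N)))"
      by simp
    show "(\<lambda>n. K * (2 * (1 / real (n + Suc N)))) \<longlonglongrightarrow> 0"
      by (intro tendsto_mult_right_zero lim1)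
  qed
  have L: "(\<lambda>N. \<Prod>k<N. q k / p k) \<longlonglongrightarrow> rGamma (1 + b) * rGamma (1 + c) * rGamma (1 - d) / (rGamma (1 + d) * rGamma (1 - b) * rGamma (1 - c))"
  proof -
    have eq: "(\<Prod>k<N. q k / p k) = pochhammer (1+b) N * pochhammer (1+c) N * pochhammer (1-d) N / (pochhammer (1+d) N * pochhammer (1-b) N * pochhammer (1-c) N)" for N
    proof -
      have "(\<Prod>k<N. q k / p k) = (\<Prod>k<N. (1 + b + of_nat k) * (1 + c + of_nat k) * (1 - d + of_nat k) / ((1 + d + of_nat k) * (1 - b + of_nat k) * (1 - c + of_nat k)))"
        by (intro prod.cong refl) (simp add: q_def p_def add_ac diff_add_eq add_diff_eq)
      then show ?thesis by (simp add: pochhammer_prod prod_dividef prod.distrib atLeast0LessThan)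
    qed
    show ?thesis unfolding eq
      using Re dbc by (intro pochhammer_ratio_tendsto_rGamma Re_pos_not_nonpos_Int) auto
  qed
  have u: "u = U 0" using d0
    by (simp add: U_def V_def u_def fun_eq_iff pochhammer_fact mult_ac)
  note wz = wz_summation[OF rec _ _ glim _ bound M ulim L]
  have p0: "p N \<noteq> 0" for N unfolding p_def using Suc_nz[of d N] Suc_nz[of "-b" N] Suc_nz[of "-c" N] Re by (simp del: of_nat_Suc)
  have g00: "g N 0 = 0" and U0: "U N 0 = 1" for N using nz0[of N] by (simp_all add: g_def U_def V_def)
  show "summable u" unfolding u by (rule wz[OF p0 g00 U0])
  have "suminf u * (rGamma (1 + b) * rGamma (1 + c) * rGamma (1 - d) / (rGamma (1 + d) * rGamma (1 - b) * rGamma (1 - c))) = 1"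
    unfolding u by (rule wz[OF p0 g00 U0])
  then show "suminf u * (rGamma (1 + b) * rGamma (1 + c) * rGamma (1 - d)) =
           rGamma (1 + d) * rGamma (1 - b) * rGamma (1 - c)"
    by (simp add: divide_simps split: if_splits)
qed

section \<open>Germs of power series\<close>

lemma holo_germ_const: "holo_germ (\<lambda>x y. c)"
proof -
  have "((\<lambda>(i, j). (if i = 0 \<and> j = 0 then c else 0) * x ^ i * y ^ j) has_sum c) UNIV" for x y :: complex
  proof -
    have "((\<lambda>(i, j). (if i = 0 \<and> j = 0 then c else 0) * x ^ i * y ^ j) has_sum c) UNIV \<longleftrightarrow>
       ((\<lambda>(i::nat, j::nat). c) has_sum c) {(0, 0)}"
      by (rule has_sum_cong_neutral) (auto split: if_splits)
    then show ?thesis by (auto intro!: has_sum_finiteI)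
  qed
  then show ?thesis unfolding holo_germ_def
    by (intro exI[of _ "\<lambda>i j. if i = 0 \<and> j = 0 then c else 0"]) (auto intro!: always_eventually)
qed

lemma holo_germ_add:
  assumes "holo_germ f" "holo_germ g"
  shows "holo_germ (\<lambda>x y. f x y + g x y)"
proof -
  obtain a b where a: "\<forall>\<^sub>F (x, y) in nhds (0, 0). ((\<lambda>(i, j). a i j * x ^ i * y ^ j) has_sum f x y) UNIV"
    and b: "\<forall>\<^sub>F (x, y) in nhds (0, 0). ((\<lambda>(i, j). b i j * x ^ i * y ^ j) has_sum g x y) UNIV"
    using assms unfolding holo_germ_def by blast
  have "\<forall>\<^sub>F (x, y) in nhds (0, 0). ((\<lambda>(i, j). (a i j + b i j) * x ^ i * y ^ j) has_sum (f x y + g x y)) UNIV"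
    using a b
  proof eventually_elim
    case (elim z)
    then show ?case
      by (auto simp: case_prod_unfold distrib_right dest: has_sum_add)
  qed
  then show ?thesis unfolding holo_germ_def by (intro exI[of _ "\<lambda>i j. a i j + b i j"])
qed

lemma holo_germ_cmult:
  assumes "holo_germ f"
  shows "holo_germ (\<lambda>x y. c * f x y)"
proof -
  obtain a where a: "\<forall>\<^sub>F (x, y) in nhds (0, 0). ((\<lambda>(i, j). a i j * x ^ i * y ^ j) has_sum f x y) UNIV"
    using assms unfolding holo_germ_def by blast
  have "\<forall>\<^sub>F (x, y) in nhds (0, 0). ((\<lambda>(i, j). (c * a i j) * x ^ i * y ^ j) has_sum (c * f x y)) UNIV"
    using a
  proof eventually_elim
    case (elim z)
    then show ?case
      by (auto simp: case_prod_unfold mult.assoc dest: has_sum_cmult_right)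
  qed
  then show ?thesis unfolding holo_germ_def by (intro exI[of _ "\<lambda>i j. c * a i j"])
qed

lemma holo_germ_diff:
  assumes "holo_germ f" "holo_germ g"
  shows "holo_germ (\<lambda>x y. f x y - g x y)"
  using holo_germ_add[OF assms(1) holo_germ_cmult[OF assms(2), of "-1"]] by simp

text \<open>Clearing the denominators of the two series only involves multiplication by coordinates.
  Shifting the coefficient array is enough for this and avoids Cauchy products of double
  series.\<close>

lemma holo_germ_mult_fst:
  assumes "holo_germ f"
  shows "holo_germ (\<lambda>x y. x * f x y)"
proof -
  obtain a where a: "\<forall>\<^sub>F (x, y) in nhds (0, 0). ((\<lambda>(i, j). a i j * x ^ i * y ^ j) has_sum f x y) UNIV"
    using assms unfolding holo_germ_def by blast
  define b where "b = (\<lambda>i j. case i of 0 \<Rightarrow> 0 | Suc i \<Rightarrow> a i j)"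
  have "((\<lambda>(i, j). b i j * x ^ i * y ^ j) has_sum (x * f x y)) UNIV"
    if "((\<lambda>(i, j). a i j * x ^ i * y ^ j) has_sum f x y) UNIV" for x y
  proof -
    have "((\<lambda>(i, j). a i j * x ^ Suc i * y ^ j) has_sum (x * f x y)) UNIV"
      using has_sum_cmult_right[OF that, of x] by (simp add: case_prod_unfold mult_ac)
    also have "?this \<longleftrightarrow> ((\<lambda>(i, j). b i j * x ^ i * y ^ j) has_sum (x * f x y)) ({1..} \<times> UNIV)"
      by (rule has_sum_reindex_bij_witness[of _ "\<lambda>(i, j). (i - 1, j)" "\<lambda>(i, j). (Suc i, j)"])
         (auto simp: b_def)
    also have "\<dots> \<longleftrightarrow> ((\<lambda>(i, j). b i j * x ^ i * y ^ j) has_sum (x * f x y)) UNIV"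
      by (rule has_sum_cong_neutral) (auto simp: b_def split: nat.splits)
    finally show ?thesis .
  qed
  with a have "\<forall>\<^sub>F (x, y) in nhds (0, 0). ((\<lambda>(i, j). b i j * x ^ i * y ^ j) has_sum (x * f x y)) UNIV"
    by (auto elim!: eventually_mono)
  then show ?thesis unfolding holo_germ_def by (intro exI[of _ b])
qed

lemma holo_germ_mult_snd:
  assumes "holo_germ f"
  shows "holo_germ (\<lambda>x y. y * f x y)"
proof -
  obtain a where a: "\<forall>\<^sub>F (x, y) in nhds (0, 0). ((\<lambda>(i, j). a i j * x ^ i * y ^ j) has_sum f x y) UNIV"
    using assms unfolding holo_germ_def by blast
  define b where "b = (\<lambda>i j. case j of 0 \<Rightarrow> 0 | Suc j \<Rightarrow> a i j)"
  have "((\<lambda>(i, j). b i j * x ^ i * y ^ j) has_sum (y * f x y)) UNIV"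
    if "((\<lambda>(i, j). a i j * x ^ i * y ^ j) has_sum f x y) UNIV" for x y
  proof -
    have "((\<lambda>(i, j). a i j * x ^ i * y ^ Suc j) has_sum (y * f x y)) UNIV"
      using has_sum_cmult_right[OF that, of y] by (simp add: case_prod_unfold mult_ac)
    also have "?this \<longleftrightarrow> ((\<lambda>(i, j). b i j * x ^ i * y ^ j) has_sum (y * f x y)) (UNIV \<times> {1..})"
      by (rule has_sum_reindex_bij_witness[of _ "\<lambda>(i, j). (i, j - 1)" "\<lambda>(i, j). (i, Suc j)"])
         (auto simp: b_def)
    also have "\<dots> \<longleftrightarrow> ((\<lambda>(i, j). b i j * x ^ i * y ^ j) has_sum (y * f x y)) UNIV"
      by (rule has_sum_cong_neutral) (auto simp: b_def split: nat.splits)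
    finally show ?thesis .
  qed
  with a have "\<forall>\<^sub>F (x, y) in nhds (0, 0). ((\<lambda>(i, j). b i j * x ^ i * y ^ j) has_sum (y * f x y)) UNIV"
    by (auto elim!: eventually_mono)
  then show ?thesis unfolding holo_germ_def by (intro exI[of _ b])
qed

lemma eventually_nhds_00_iff:
  "(\<forall>\<^sub>F (x :: complex, y :: complex) in nhds (0, 0). P x y) \<longleftrightarrow>
     (\<exists>r>0. \<forall>x y. norm x < r \<longrightarrow> norm y < r \<longrightarrow> P x y)"
proof
  assume "\<forall>\<^sub>F (x, y) in nhds (0, 0). P x y"
  then obtain d where d: "d > 0" "\<And>x y. dist (x, y) (0, 0) < d \<Longrightarrow> P x y"
    unfolding eventually_nhds_metric by auto
  show "\<exists>r>0. \<forall>x y. norm x < r \<longrightarrow> norm y < r \<longrightarrow> P x y"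
  proof (intro exI[of _ "d/2"] conjI allI impI)
    fix x y :: complex assume "norm x < d/2" "norm y < d/2"
    hence "dist (x, y) (0, 0) < d"
      using norm_Pair_le[of x y] by (simp add: dist_norm)
    then show "P x y" by (rule d)
  qed (use d in auto)
next
  assume "\<exists>r>0. \<forall>x y. norm x < r \<longrightarrow> norm y < r \<longrightarrow> P x y"
  then obtain r where r: "r > 0" "\<And>x y. norm x < r \<Longrightarrow> norm y < r \<Longrightarrow> P x y" by blast
  show "\<forall>\<^sub>F (x, y) in nhds (0, 0). P x y"
    unfolding eventually_nhds_metric
  proof (intro exI[of _ r] conjI allI impI r(1))
    fix z :: "complex \<times> complex" assume "dist z (0, 0) < r"
    hence "norm (fst z) < r" "norm (snd z) < r"
      using norm_fst_le[of "fst z" "snd z"] norm_snd_le[of "snd z" "fst z"] by (auto simp: dist_norm zero_prod_def[symmetric])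
    thus "case z of (x, y) \<Rightarrow> P x y" using r(2) by (auto simp: case_prod_unfold)
  qed
qed

text \<open>A power series is continuous inside its disc. As \<open>S\<close> is finite, the
  function vanishes on a punctured neighbourhood of \<open>w\<close>, so its value at
  \<open>w\<close> is the limit 0.\<close>

lemma power_series_zero_off_finite:
  fixes f :: "complex \<Rightarrow> complex"
  assumes f: "\<And>z. norm z < r \<Longrightarrow> ((\<lambda>j. c j * z ^ j) has_sum f z) UNIV"
    and S: "finite S" and zero: "\<And>z. norm z < r \<Longrightarrow> z \<notin> S \<Longrightarrow> f z = 0"
    and w: "norm w < r"
  shows "f w = 0"
proof -
  have sums: "(\<lambda>j. c j * z ^ j) sums f z" if "norm z < r" for z
    using f[OF that] by (rule has_sum_imp_sums)
  obtain K where K: "norm w < K" "K < r" using dense[OF w] by blast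
  have "isCont (\<lambda>z. \<Sum>j. c j * z ^ j) w"
    by (rule isCont_powser[of c "of_real K"]) (use sums[of "of_real K"] K norm_ge_zero[of w] in \<open>auto simp: sums_iff\<close>)
  moreover have "\<forall>\<^sub>F z in nhds w. z \<in> ball 0 r"
    using w by (intro eventually_nhds_in_open) auto
  hence "\<forall>\<^sub>F z in nhds w. (\<Sum>j. c j * z ^ j) = f z"
    by eventually_elim (use sums in \<open>auto simp: sums_iff\<close>)
  ultimately have "isCont f w" by (subst (asm) isCont_cong)
  hence lim: "f \<midarrow>w\<rightarrow> f w" by (simp add: isCont_def)
  have "open (ball 0 r - (S - {w}))" using S by (intro open_Diff finite_imp_closed) auto
  hence "\<forall>\<^sub>F z in nhds w. z \<in> ball 0 r - (S - {w})"
    using w by (intro eventually_nhds_in_open) auto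
  hence "\<forall>\<^sub>F z in at w. f z = 0"
    unfolding eventually_at_filter by eventually_elim (use zero in auto)
  hence "f \<midarrow>w\<rightarrow> 0" by (rule tendsto_eventually)
  with lim show ?thesis using LIM_unique by blast
qed

text \<open>The argument goes slice by slice. For fixed x other than 0 the lines meet the slice only
  in y = x and y = -x, so \<open>h\<close> vanishes on the whole slice. Then for fixed y the only
  exceptional point left is x = 0.\<close>

lemma holo_germ_eq_0_if_eq_0_off_lines:
  assumes h: "holo_germ h"
    and zero: "\<forall>\<^sub>F (x, y) in nhds (0, 0). x \<noteq> 0 \<and> x + y \<noteq> 0 \<and> y - x \<noteq> 0 \<longrightarrow> h x y = 0"
  shows "\<forall>\<^sub>F (x, y) in nhds (0, 0). h x y = 0"
proof -
  obtain a where a: "\<forall>\<^sub>F (x, y) in nhds (0, 0). ((\<lambda>(i, j). a i j * x ^ i * y ^ j) has_sum h x y) UNIV"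
    using h unfolding holo_germ_def by blast
  from a zero have "\<forall>\<^sub>F (x, y) in nhds (0, 0). ((\<lambda>(i, j). a i j * x ^ i * y ^ j) has_sum h x y) UNIV \<and>
     (x \<noteq> 0 \<and> x + y \<noteq> 0 \<and> y - x \<noteq> 0 \<longrightarrow> h x y = 0)"
    by eventually_elim auto
  then obtain r where r: "r > 0" and sum: "\<And>x y. norm x < r \<Longrightarrow> norm y < r \<Longrightarrow>
        ((\<lambda>(i, j). a i j * x ^ i * y ^ j) has_sum h x y) UNIV"
      and z: "\<And>x y. norm x < r \<Longrightarrow> norm y < r \<Longrightarrow> x \<noteq> 0 \<Longrightarrow> x + y \<noteq> 0 \<Longrightarrow> y - x \<noteq> 0 \<Longrightarrow> h x y = 0"
    unfolding eventually_nhds_00_iff by blast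
  \<comment> \<open>Summing over the first index turns the double series on a slice into a power
    series in one variable. It is stated for arbitrary \<open>a\<close> and \<open>h\<close> so that
    it also serves with the roles of x and y exchanged.\<close>
  have coeff: "\<exists>c. \<forall>y. norm y < r \<longrightarrow> ((\<lambda>j. c j * y ^ j) has_sum h x y) UNIV"
    if sum: "\<And>y. norm y < r \<Longrightarrow> ((\<lambda>(i, j). a i j * x ^ i * y ^ j) has_sum h x y) UNIV"
    for x and a :: "nat \<Rightarrow> nat \<Rightarrow> complex" and h
  proof (intro exI[of _ "\<lambda>j. \<Sum>\<^sub>\<infinity>i. a i j * x ^ i"] allI impI)
    have sl: "(\<lambda>i. a i j * x ^ i * y ^ j) summable_on UNIV" if "norm y < r" for y j
    proof -
      have "(\<lambda>(j, i). a i j * x ^ i * y ^ j) summable_on UNIV \<times> UNIV"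
        using has_sum_imp_summable[OF sum[OF that]] by (subst summable_on_swap) (simp add: case_prod_unfold)
      from summable_on_SigmaD1[OF this, of j] show ?thesis by simp
    qed
    \<comment> \<open>The point r/2 lies in the disc and is nonzero, so the constant factor y^j can
      be cancelled.\<close>
    have sl': "(\<lambda>i. a i j * x ^ i) summable_on UNIV" for j
      using sl[of "of_real (r/2)" j] r by (simp add: summable_on_cmult_left')
    fix y :: complex assume y: "norm y < r"
    have "((\<lambda>(j, i). a i j * x ^ i * y ^ j) has_sum h x y) (UNIV \<times> UNIV)"
      using sum[OF y] by (subst has_sum_swap) (simp add: case_prod_unfold)
    then show "((\<lambda>j. (\<Sum>\<^sub>\<infinity>i. a i j * x ^ i) * y ^ j) has_sum h x y) UNIV"
      by (rule has_sum_SigmaD) (auto intro!: has_sum_cmult_left has_sum_infsum sl')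
  qed
  have 1: "h x y = 0" if x: "norm x < r" "x \<noteq> 0" and y: "norm y < r" for x y
  proof -
    from coeff[where x = x and a = a and h = h, OF sum[OF x(1)]] obtain c where c: "\<forall>y. norm y < r \<longrightarrow> ((\<lambda>j. c j * y ^ j) has_sum h x y) UNIV"
      by blast
    show ?thesis
    proof (rule power_series_zero_off_finite[of r c "h x" "{x, -x}"])
      fix z assume "norm z < r" "z \<notin> {x, -x}"
      then show "h x z = 0" using z[of x z] x by (auto simp: add_eq_0_iff)
    qed (use c y in auto)
  qed
  have 2: "h x y = 0" if x: "norm x < r" and y: "norm y < r" for x y
  proof -
    have "((\<lambda>(i, j). a j i * y ^ i * x ^ j) has_sum h x y) UNIV" if "norm x < r" for x
      using sum[OF that y] has_sum_swap[where f = "\<lambda>(i, j). a i j * x ^ i * y ^ j" and S = "h x y" and A = UNIV and B = UNIV]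
      by (simp add: case_prod_unfold mult_ac)
    from coeff[where a = "\<lambda>i j. a j i" and x = y and h = "\<lambda>y x. h x y", OF this]
    obtain c where c: "\<forall>x. norm x < r \<longrightarrow> ((\<lambda>j. c j * x ^ j) has_sum h x y) UNIV"
      by blast
    show ?thesis
      by (rule power_series_zero_off_finite[of r c "\<lambda>x. h x y" "{0}"]) (use c x y 1 in auto)
  qed
  show ?thesis unfolding eventually_nhds_00_iff using r 2 by blast
qed

section \<open>Generating functions of multiple zeta values\<close>

definition incr_lists :: "nat set \<Rightarrow> nat \<Rightarrow> nat list set" where
  "incr_lists D j = {ns. length ns = j \<and> sorted_wrt (<) ns \<and> set ns \<subseteq> D}"

definition mzv_term :: "nat list \<Rightarrow> nat list \<Rightarrow> real" where
  "mzv_term ks ns = (\<Prod>i<length ks. 1 / real (ns ! i) ^ (ks ! i))"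

text \<open>These are the multiple harmonic sums: what is left of a multiple zeta value once its
  largest variable is fixed to be \<open>m\<close> and the last entry is split off.\<close>

definition mzv_below :: "nat list \<Rightarrow> nat \<Rightarrow> real" where
  "mzv_below ks m = (\<Sum>ns\<in>incr_lists {0<..<m} (length ks). mzv_term ks ns)"

lemma mzv_term_nonneg: "mzv_term ks ns \<ge> 0"
  by (simp add: mzv_term_def prod_nonneg)

lemma mzv_below_nonneg: "mzv_below ks m \<ge> 0"
  by (simp add: mzv_below_def sum_nonneg mzv_term_nonneg)

lemma mzv_term_snoc:
  "length ns = length ks \<Longrightarrow> mzv_term (ks @ [k]) (ns @ [n]) = mzv_term ks ns / real n ^ k"
  by (simp add: mzv_term_def nth_append)

lemma finite_incr_lists: "finite D \<Longrightarrow> finite (incr_lists D j)"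
  by (rule finite_subset[OF _ finite_lists_length_eq[of D j]]) (auto simp: incr_lists_def)

text \<open>An increasing list is its largest entry together with an increasing list below it.
  Keeping \<open>D\<close> general lets one bijection serve both the finite truncated sums and the
  full infinite sum.\<close>

lemma bij_betw_incr_lists_snoc:
  assumes "\<And>n. n \<in> D \<Longrightarrow> {0<..<n} \<subseteq> D" and "0 \<notin> D"
  shows "bij_betw (\<lambda>(n, ns). ns @ [n]) (SIGMA n:D. incr_lists {0<..<n} j) (incr_lists D (Suc j))"
proof (rule bij_betwI[of _ _ _ "\<lambda>ns. (last ns, butlast ns)"])
  show "(\<lambda>(n, ns). ns @ [n]) \<in> (SIGMA n:D. incr_lists {0<..<n} j) \<rightarrow> incr_lists D (Suc j)"
    using assms by (auto simp: incr_lists_def sorted_wrt_append subset_iff)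
  show "(\<lambda>ns. (last ns, butlast ns)) \<in> incr_lists D (Suc j) \<rightarrow> (SIGMA n:D. incr_lists {0<..<n} j)"
  proof
    fix ns assume ns: "ns \<in> incr_lists D (Suc j)"
    then obtain ms n where "ns = ms @ [n]"
      by (cases ns rule: rev_cases) (auto simp: incr_lists_def)
    with ns assms show "(last ns, butlast ns) \<in> (SIGMA n:D. incr_lists {0<..<n} j)"
      by (auto simp: incr_lists_def sorted_wrt_append subset_iff intro!: gr0I)
  qed
qed (auto simp: incr_lists_def intro!: append_butlast_last_id)

lemma mzv_below_Nil [simp]: "mzv_below [] m = 1"
  by (simp add: mzv_below_def incr_lists_def mzv_term_def cong: conj_cong)

lemma mzv_below_snoc: "mzv_below (ks @ [k]) m = (\<Sum>n\<in>{0<..<m}. mzv_below ks n / real n ^ k)"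
proof -
  have "mzv_below (ks @ [k]) m =
     (\<Sum>(n, ns)\<in>(SIGMA n:{0<..<m}. incr_lists {0<..<n} (length ks)). mzv_term (ks @ [k]) (ns @ [n]))"
    using sum.reindex_bij_betw[OF bij_betw_incr_lists_snoc[of "{0<..<m}" "length ks"], of "mzv_term (ks @ [k])"]
    by (force simp: mzv_below_def case_prod_unfold)
  also have "\<dots> = (\<Sum>n\<in>{0<..<m}. \<Sum>ns\<in>incr_lists {0<..<n} (length ks). mzv_term (ks @ [k]) (ns @ [n]))"
    by (rule sum.Sigma[symmetric]) (auto intro: finite_incr_lists)
  also have "\<dots> = (\<Sum>n\<in>{0<..<m}. mzv_below ks n / real n ^ k)"
    unfolding mzv_below_def sum_divide_distrib
    by (intro sum.cong refl mzv_term_snoc) (auto simp: incr_lists_def)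
  finally show ?thesis .
qed

lemma mzv_below_snoc_Suc:
  "mzv_below (ks @ [k]) (Suc (Suc m)) = mzv_below (ks @ [k]) (Suc m) + mzv_below ks (Suc m) / real (Suc m) ^ k"
proof -
  have "{0<..<Suc (Suc m)} = insert (Suc m) {0<..<Suc m}" by auto
  then show ?thesis by (simp add: mzv_below_snoc)
qed

lemma mzv_below_snoc_1 [simp]: "mzv_below (ks @ [k]) (Suc 0) = 0"
proof -
  have "{0<..<Suc 0} = {}" by auto
  then show ?thesis by (simp only: mzv_below_snoc sum.empty)
qed

text \<open>The index \<open>m\<close> stands for the largest variable m + 1. Summability has to be
  assumed, as \<open>mzv\<close> is a default 0 otherwise; since all terms are nonnegative,
  summability of the iterated sum gives that of the joint one.\<close>

lemma mzv_snoc_has_sum: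
  assumes "(\<lambda>m. mzv_below ks (Suc m) / real (Suc m) ^ k) summable_on UNIV"
  shows "((\<lambda>m. mzv_below ks (Suc m) / real (Suc m) ^ k) has_sum mzv (ks @ [k])) UNIV"
proof -
  have bij: "bij_betw (\<lambda>(n, ns). ns @ [n]) (SIGMA n:{0<..}. incr_lists {0<..<n} (length ks))
               (incr_lists {0<..} (Suc (length ks)))"
    by (rule bij_betw_incr_lists_snoc) auto
  let ?S = "SIGMA n:{0<..}. incr_lists {0<..<n} (length ks)"
  let ?f = "\<lambda>(n, ns). mzv_term (ks @ [k]) (ns @ [n])"
  have iff: "((\<lambda>m. mzv_below ks (Suc m) / real (Suc m) ^ k) has_sum s) UNIV \<longleftrightarrow>
         ((\<lambda>n. mzv_below ks n / real n ^ k) has_sum s) {0<..}" for s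
    by (rule has_sum_reindex_bij_witness[of _ "\<lambda>n. n - 1" Suc]) auto
  have sm: "(\<lambda>n. mzv_below ks n / real n ^ k) summable_on {0<..}"
    using assms iff by (auto simp: summable_on_def)
  have inner: "((\<lambda>ns. ?f (n, ns)) has_sum mzv_below ks n / real n ^ k) (incr_lists {0<..<n} (length ks))" for n
    by (rule has_sum_finiteI[OF finite_incr_lists])
       (auto simp: mzv_below_def sum_divide_distrib incr_lists_def mzv_term_snoc intro!: sum.cong)
  have "?f summable_on ?S"
    by (rule summable_on_SigmaI[OF inner sm]) (auto simp: mzv_term_nonneg)
  hence "(?f has_sum infsum ?f ?S) ?S" by simp
  moreover have "infsum ?f ?S = infsum (mzv_term (ks @ [k])) (incr_lists {0<..} (Suc (length ks)))"
    using infsum_reindex_bij_betw[OF bij, of "mzv_term (ks @ [k])"]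
    by (simp add: case_prod_unfold)
  moreover have "\<dots> = mzv (ks @ [k])"
    unfolding mzv_def mzv_term_def incr_lists_def by (rule arg_cong2[where f = infsum]) auto
  ultimately have "(?f has_sum mzv (ks @ [k])) ?S" by simp
  from has_sum_SigmaD[OF this inner] show ?thesis unfolding iff .
qed

section \<open>Weights of the largest variable and their generating functions\<close>

lemma has_sum_shift_Suc:
  fixes f :: "nat \<Rightarrow> 'a :: topological_comm_monoid_add"
  assumes "(f has_sum s) UNIV"
  shows "((\<lambda>r. case r of 0 \<Rightarrow> 0 | Suc r \<Rightarrow> f r) has_sum s) UNIV"
proof -
  let ?g = "\<lambda>r. case r of 0 \<Rightarrow> 0 | Suc r \<Rightarrow> f r"
  have "(f has_sum s) UNIV \<longleftrightarrow> (?g has_sum s) {1..}"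
    by (rule has_sum_reindex_bij_witness[of _ "\<lambda>n. n - 1" Suc]) auto
  also have "\<dots> \<longleftrightarrow> (?g has_sum s) UNIV"
    by (rule has_sum_cong_neutral) (auto split: nat.splits)
  finally show ?thesis using assms by simp
qed

lemma has_sum_delta_0:
  "((\<lambda>r::nat. (if r = 0 then 1 else 0) * y ^ r) has_sum (1::complex)) UNIV"
proof -
  have "((\<lambda>r::nat. (if r = 0 then 1 else 0) * y ^ r) has_sum (1::complex)) UNIV \<longleftrightarrow>
        ((\<lambda>r::nat. 1) has_sum (1::complex)) {0}"
    by (rule has_sum_cong_neutral) auto
  then show ?thesis by (auto intro!: has_sum_finiteI)
qed

text \<open>The elementary symmetric polynomial of degree \<open>r\<close> in 1, 1/2, ...,
  1/m.\<close>

definition H_weight :: "nat \<Rightarrow> nat \<Rightarrow> real" where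
  "H_weight m r = mzv_below (replicate r 1) (Suc m)"

lemma H_weight_nonneg: "H_weight m r \<ge> 0" by (simp add: H_weight_def mzv_below_nonneg)

lemma H_weight_0: "H_weight 0 r = (if r = 0 then 1 else 0)"
  by (cases r) (simp_all add: H_weight_def flip: replicate_append_same)

lemma H_weight_Suc: "H_weight (Suc m) r = H_weight m r + (case r of 0 \<Rightarrow> 0 | Suc r \<Rightarrow> H_weight m r / real (Suc m))"
  by (cases r) (simp_all add: H_weight_def mzv_below_snoc_Suc flip: replicate_append_same)

lemma H_weight_has_sum:
  "((\<lambda>r. of_real (H_weight m r) * y ^ r) has_sum (\<Prod>i<m. 1 + y / of_nat (Suc i))) (UNIV :: nat set)"
  for y :: complex
proof (induction m)
  case 0
  then show ?case using has_sum_delta_0[of y] by (auto simp: H_weight_0 if_distrib cong: if_cong)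
next
  case (Suc m)
  let ?P = "\<Prod>i<m. 1 + y / of_nat (Suc i) :: complex"
  have "((\<lambda>r. (case r of 0 \<Rightarrow> 0 | Suc r \<Rightarrow> of_real (H_weight m r) * y ^ r) * (y / of_nat (Suc m))) has_sum (?P * (y / of_nat (Suc m)))) UNIV"
    by (intro has_sum_cmult_left has_sum_shift_Suc Suc)
  from has_sum_add[OF Suc this]
  have "((\<lambda>r. of_real (H_weight m r) * y ^ r + (case r of 0 \<Rightarrow> 0 | Suc r \<Rightarrow> of_real (H_weight m r) * y ^ r) * (y / of_nat (Suc m))) has_sum
     (\<Prod>i<Suc m. 1 + y / of_nat (Suc i))) UNIV"
    by (simp add: algebra_simps)
  also have "(\<lambda>r. of_real (H_weight m r) * y ^ r + (case r of 0 \<Rightarrow> 0 | Suc r \<Rightarrow> of_real (H_weight m r) * y ^ r) * (y / of_nat (Suc m))) =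
       (\<lambda>r. of_real (H_weight (Suc m) r) * y ^ r)"
    by (rule ext) (simp add: H_weight_Suc distrib_right split: nat.splits)
  finally show ?case .
qed

definition compositions12 :: "nat \<Rightarrow> nat list set" where
  "compositions12 r = {rs. set rs \<subseteq> {1, 2} \<and> sum_list rs = r}"

lemma finite_compositions12: "finite (compositions12 r)"
proof (rule finite_subset)
  have "length rs \<le> sum_list rs" if "set rs \<subseteq> {1, 2::nat}" for rs
    using that by (induction rs) auto
  then show "compositions12 r \<subseteq> {rs. set rs \<subseteq> {1, 2} \<and> length rs \<le> r}"
    by (auto simp: compositions12_def)
  show "finite {rs. set rs \<subseteq> {1, 2::nat} \<and> length rs \<le> r}"
    by (rule finite_lists_length_le) simp
qed

lemma compositions12_0: "compositions12 0 = {[]}"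
proof -
  have "rs = []" if "set rs \<subseteq> {1, 2::nat}" "sum_list rs = 0" for rs
    using that by (cases rs) auto
  then show ?thesis by (auto simp: compositions12_def)
qed

lemma compositions12_Suc:
  "compositions12 (Suc r) = (\<lambda>rs. rs @ [1]) ` compositions12 r \<union>
     (case r of 0 \<Rightarrow> {} | Suc r' \<Rightarrow> (\<lambda>rs. rs @ [2]) ` compositions12 r')"
  (is "?L = ?R")
proof (rule Set.equalityI)
  show "?L \<subseteq> ?R"
  proof
    fix rs assume rs: "rs \<in> ?L"
    then obtain qs q where q: "rs = qs @ [q]"
      by (cases rs rule: rev_cases) (auto simp: compositions12_def)
    with rs show "rs \<in> ?R" by (cases r) (auto simp: compositions12_def)
  qed
  show "?R \<subseteq> ?L" by (cases r) (auto simp: compositions12_def)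
qed

lemma sum_compositions12_Suc:
  fixes f :: "nat list \<Rightarrow> real"
  shows "(\<Sum>rs\<in>compositions12 (Suc r). f rs) = (\<Sum>rs\<in>compositions12 r. f (rs @ [1])) +
     (case r of 0 \<Rightarrow> 0 | Suc r' \<Rightarrow> \<Sum>rs\<in>compositions12 r'. f (rs @ [2]))"
proof (cases r)
  case 0
  then show ?thesis by (simp add: compositions12_Suc compositions12_0)
next
  case (Suc r')
  have "(\<Sum>rs\<in>compositions12 (Suc r). f rs) =
      sum f ((\<lambda>rs. rs @ [1]) ` compositions12 r) + sum f ((\<lambda>rs. rs @ [2]) ` compositions12 r')"
    by (subst compositions12_Suc, unfold Suc nat.case, rule sum.union_disjoint)
       (auto simp: finite_compositions12)
  then show ?thesis
    using Suc by (simp add: sum.reindex inj_on_def)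
qed

text \<open>The coefficient of y^r in the product of (1 + y/i)^2 over i = 1, ..., m: a part 1 at i
  comes with 2/i, a part 2 with 1/i^2. \<open>Z_weight_Suc\<close> is multiplication by the last of
  these factors.\<close>

definition Z_weight :: "nat \<Rightarrow> nat \<Rightarrow> real" where
  "Z_weight m r = (\<Sum>rs\<in>compositions12 r. 2 ^ count_list rs 1 * mzv_below rs (Suc m))"

lemma Z_weight_nonneg: "Z_weight m r \<ge> 0" 
  by (simp add: Z_weight_def mzv_below_nonneg sum_nonneg)

lemma Z_weight_0: "Z_weight 0 r = (if r = 0 then 1 else 0)"
proof (cases r)
  case (Suc r')
  then show ?thesis by (auto simp: Z_weight_def sum_compositions12_Suc split: nat.splits)
qed (simp add: Z_weight_def compositions12_0)

lemma Z_weight_Suc: "Z_weight (Suc m) r = Z_weight m r +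
   (case r of 0 \<Rightarrow> 0 | Suc r' \<Rightarrow> 2 * Z_weight m r' / real (Suc m) + 
      (case r' of 0 \<Rightarrow> 0 | Suc r'' \<Rightarrow> Z_weight m r'' / real (Suc m) ^ 2))"
proof (cases r)
  case (Suc r')
  show ?thesis unfolding Suc nat.case
    unfolding Z_weight_def sum_compositions12_Suc
    by (cases r') (simp_all add: mzv_below_snoc_Suc sum.distrib distrib_left sum_distrib_left sum_divide_distrib mult_ac del: of_nat_Suc)
qed (simp add: Z_weight_def compositions12_0)

lemma Z_weight_has_sum:
  "((\<lambda>r. of_real (Z_weight m r) * y ^ r) has_sum (\<Prod>i<m. 1 + y / of_nat (Suc i)) ^ 2) (UNIV :: nat set)"
  for y :: complex
proof (induction m)
  case 0
  then show ?case using has_sum_delta_0[of y] by (auto simp: Z_weight_0 if_distrib cong: if_cong)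
next
  case (Suc m)
  let ?P = "(\<Prod>i<m. 1 + y / of_nat (Suc i) :: complex)\<^sup>2"
  define z where "z = y / of_nat (Suc m)"
  define f where "f = (\<lambda>r. of_real (Z_weight m r) * y ^ r)"
  \<comment> \<open>\<open>f1\<close> and \<open>f2\<close> shift whole terms, with their powers of
    \<open>y\<close>; the missing one or two powers are supplied by \<open>z\<close>, so that the
    three series add up to the factor (1 + z)^2.\<close>
  define f1 where "f1 = (\<lambda>r. case r of 0 \<Rightarrow> 0 | Suc r \<Rightarrow> f r)"
  define f2 where "f2 = (\<lambda>r. case r of 0 \<Rightarrow> 0 | Suc r \<Rightarrow> f1 r)"
  have f: "(f has_sum ?P) UNIV" using Suc by (simp add: f_def)
  have f1: "(f1 has_sum ?P) UNIV" unfolding f1_def by (rule has_sum_shift_Suc[OF f])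
  have f2: "(f2 has_sum ?P) UNIV" unfolding f2_def by (rule has_sum_shift_Suc[OF f1])
  have "((\<lambda>r. f r + f1 r * (2 * z) + f2 r * z\<^sup>2) has_sum (?P + ?P * (2 * z) + ?P * z\<^sup>2)) UNIV"
    by (intro has_sum_add has_sum_cmult_left f f1 f2)
  also have "?P + ?P * (2 * z) + ?P * z\<^sup>2 = (\<Prod>i<Suc m. 1 + y / of_nat (Suc i))\<^sup>2"
    unfolding prod.lessThan_Suc z_def[symmetric] by (simp add: power2_eq_square algebra_simps)
  also have "(\<lambda>r. f r + f1 r * (2 * z) + f2 r * z\<^sup>2) = (\<lambda>r. of_real (Z_weight (Suc m) r) * y ^ r)"
    by (rule ext)
       (simp add: f_def f1_def f2_def z_def Z_weight_Suc distrib_right distrib_left power_divide power2_eq_square mult_ac split: nat.splits del: of_nat_Suc)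
  finally show ?case .
qed

section \<open>The even part of the binomial and geometric series\<close>

lemma even_binomial_has_sum:
  fixes x y :: "'a :: {real_normed_field, banach}"
  shows "((\<lambda>j. of_nat (b choose (2 * j)) * x ^ (b - 2 * j) * y ^ (2 * j)) has_sum
            ((x + y) ^ b + (x - y) ^ b) / 2) UNIV"
proof -
  have bin: "((\<lambda>k. of_nat (b choose k) * y ^ k * x ^ (b - k)) has_sum (y + x) ^ b) UNIV" for y
  proof -
    have "((\<lambda>k. of_nat (b choose k) * y ^ k * x ^ (b - k)) has_sum (y + x) ^ b) {..b}"
      by (rule has_sum_finiteI) (simp_all add: binomial_ring)
    also have "?this \<longleftrightarrow> ((\<lambda>k. of_nat (b choose k) * y ^ k * x ^ (b - k)) has_sum (y + x) ^ b) UNIV"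
      by (rule has_sum_cong_neutral) auto
    finally show ?thesis .
  qed
  \<comment> \<open>Averaging the expansions at \<open>y\<close> and \<open>-y\<close> removes the
    odd powers. Indices beyond \<open>b\<close> contribute 0 through the binomial coefficient,
    whatever the truncated exponent is there.\<close>
  let ?f = "\<lambda>k. (of_nat (b choose k) * y ^ k * x ^ (b - k) + of_nat (b choose k) * (-y) ^ k * x ^ (b - k)) * (1 / 2)"
  have "(?f has_sum ((y + x) ^ b + (-y + x) ^ b) * (1 / 2)) UNIV"
    by (intro has_sum_cmult_left has_sum_add bin)
  also have "((y + x) ^ b + (-y + x) ^ b) * (1 / 2) = ((x + y) ^ b + (x - y) ^ b) / 2"
    by (simp add: add.commute)
  also have "(?f has_sum ((x + y) ^ b + (x - y) ^ b) / 2) UNIV \<longleftrightarrow> (?f has_sum ((x + y) ^ b + (x - y) ^ b) / 2) {k. even k}"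
    by (rule has_sum_cong_neutral) auto
  also have "\<dots> \<longleftrightarrow> ?thesis"
    by (rule has_sum_reindex_bij_witness[of _ "\<lambda>j. 2 * j" "\<lambda>k. k div 2"]) (auto simp: mult_ac)
  finally show ?thesis .
qed

lemma geometric_has_sum:
  fixes x :: "'a :: {real_normed_field, banach}"
  assumes "norm x < 1"
  shows "((\<lambda>b. x ^ b) has_sum 1 / (1 - x)) UNIV"
  by (rule norm_summable_imp_has_sum) (use assms geometric_sums[of x] in \<open>auto simp: norm_power summable_geometric\<close>)

lemma even_binomial_geometric_has_sum:
  fixes x y :: complex
  assumes xy: "norm x + norm y < 1"
  shows "(\<lambda>(b, j). real (b choose (2 * j)) * norm x ^ (b - 2 * j) * norm y ^ (2 * j)) summable_on UNIV"
    and "((\<lambda>(b, j). of_nat (b choose (2 * j)) * x ^ (b - 2 * j) * y ^ (2 * j)) has_sum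
            (1 / (1 - (x + y)) + 1 / (1 - (x - y))) / 2) UNIV"
proof -
  \<comment> \<open>Kept polymorphic because it is used twice: for the real numbers
    \<open>norm x\<close>, \<open>norm y\<close>, which gives the majorant, and for the complex
    series itself.\<close>
  have geo: "((\<lambda>b. ((x + y) ^ b + (x - y) ^ b) / 2) has_sum (1 / (1 - (x + y)) + 1 / (1 - (x - y))) / 2) UNIV"
    if "norm x + norm y < 1" for x y :: "'b :: {real_normed_field, banach}"
    unfolding divide_inverse[of _ 2]
    by (intro has_sum_cmult_left has_sum_add geometric_has_sum)
       (use that norm_triangle_ineq[of x y] norm_triangle_ineq4[of x y] in linarith)+
  have "(\<lambda>(b, j). real (b choose (2 * j)) * norm x ^ (b - 2 * j) * norm y ^ (2 * j)) summable_on UNIV \<times> UNIV"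
  proof (rule summable_on_SigmaI)
    show "((\<lambda>j. case (b, j) of (b, j) \<Rightarrow> real (b choose (2 * j)) * norm x ^ (b - 2 * j) * norm y ^ (2 * j)) has_sum
              ((norm x + norm y) ^ b + (norm x - norm y) ^ b) / 2) UNIV" for b
      using even_binomial_has_sum[of b "norm x" "norm y"] by simp
    show "(\<lambda>b. ((norm x + norm y) ^ b + (norm x - norm y) ^ b) / 2) summable_on UNIV"
      by (rule has_sum_imp_summable[OF geo]) (use xy in auto)
  qed auto
  then show 1: "(\<lambda>(b, j). real (b choose (2 * j)) * norm x ^ (b - 2 * j) * norm y ^ (2 * j)) summable_on UNIV"
    by simp
  have "(\<lambda>(b, j). of_nat (b choose (2 * j)) * x ^ (b - 2 * j) * y ^ (2 * j)) summable_on UNIV \<times> UNIV"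
    by (rule abs_summable_summable, rule Infinite_Sum.abs_summable_on_comparison_test'[OF 1[folded UNIV_Times_UNIV]])
       (auto simp: norm_mult norm_power)
  then show "((\<lambda>(b, j). of_nat (b choose (2 * j)) * x ^ (b - 2 * j) * y ^ (2 * j)) has_sum
            (1 / (1 - (x + y)) + 1 / (1 - (x - y))) / 2) UNIV"
    unfolding UNIV_Times_UNIV[symmetric]
    by (intro has_sum_SigmaI[OF _ geo[OF xy]]) (auto intro: even_binomial_has_sum)
qed

text \<open>The double series over \<open>(i, j)\<close> and the single series \<open>S\<close> are two groupings of one absolutely
  summable family indexed by \<open>((m, r), (b, j))\<close>, where \<open>i = b - 2j + r\<close>. The index \<open>m\<close> stands for the
  largest summation variable \<open>m + 1\<close> of a multiple zeta value.\<close>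

lemma double_generating_function:
  fixes w :: "nat \<Rightarrow> nat \<Rightarrow> real" and P :: "nat \<Rightarrow> complex \<Rightarrow> complex"
    and C :: "nat \<Rightarrow> nat \<Rightarrow> real" and X Y :: complex
  assumes w: "\<And>m r. w m r \<ge> 0"
    and gf: "\<And>m y. ((\<lambda>r. of_real (w m r) * y ^ r) has_sum P m y) UNIV"
    and P: "(\<lambda>m. norm (P m (1/4)) / real (Suc m) ^ p) summable_on UNIV"
    and C: "\<And>b r. (\<lambda>m. w m r / real (Suc m) ^ (b + p)) summable_on UNIV \<Longrightarrow>
              ((\<lambda>m. w m r / real (Suc m) ^ (b + p)) has_sum C b r) UNIV"
    and X: "norm X < 1/8" and Y: "norm Y < 1/8"
  defines "S \<equiv> \<lambda>m. P m (-2 * X) / of_nat (Suc m) ^ p *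
             ((1 / (1 - (X + Y) / of_nat (Suc m)) + 1 / (1 - (X - Y) / of_nat (Suc m))) / 2)"
  defines "T \<equiv> \<lambda>(i, j). of_real (\<Sum>r\<le>i. (-2) ^ r * real ((i + 2 * j - r) choose (2 * j)) * C (i + 2 * j - r) r)
              * X ^ i * Y ^ (2 * j)"
  shows "(T has_sum infsum S UNIV) UNIV" and "S summable_on UNIV"
proof -
  let ?n = "\<lambda>m. real (Suc m)" and ?c = "\<lambda>m. of_nat (Suc m) :: complex"
  define y where "y = -2 * X"
  have y: "norm y \<le> 1/4" using X by (simp add: y_def norm_mult)
  have XY: "norm X + norm Y < 1" using X Y by simp
  \<comment> \<open>The product of \<open>u\<close> and \<open>v\<close> majorizes the family
    \<open>G\<close>. The radius 1/8 makes \<open>norm y\<close> at most 1/4, the point at which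
    \<open>P\<close> is assumed to give a summable series.\<close>
  define u where "u = (\<lambda>(m, r). w m r * (1/4) ^ r / ?n m ^ p)"
  define v where "v = (\<lambda>(b, j). real (b choose (2 * j)) * norm X ^ (b - 2 * j) * norm Y ^ (2 * j))"
  define G where "G = (\<lambda>((m, r), (b, j)). of_real (w m r / ?n m ^ (b + p)) * y ^ r *
      (of_nat (b choose (2 * j)) * X ^ (b - 2 * j) * Y ^ (2 * j)))"
  have u0: "u mr \<ge> 0" for mr using w by (auto simp: u_def case_prod_unfold)
  have v0: "v bj \<ge> 0" for bj by (auto simp: v_def case_prod_unfold)
  \<comment> \<open>At the positive point 1/4 the generating function is a sum of nonnegative reals,
    so it equals its own norm.\<close>
  have wgf: "((\<lambda>r. w m r * (1/4) ^ r) has_sum norm (P m (1/4))) UNIV" for m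
  proof -
    have "((\<lambda>r. w m r * (1/4) ^ r) has_sum Re (P m (1/4))) UNIV"
      using has_sum_Re[OF gf[of m "1/4"]] by (simp add: power_divide flip: of_real_power of_real_divide)
    moreover have "P m (1/4) \<in> \<real>"
    proof -
      have "((\<lambda>r. 0) has_sum Im (P m (1/4))) (UNIV :: nat set)"
        using has_sum_Im[OF gf[of m "1/4"]] by (simp add: power_divide flip: of_real_power of_real_divide)
      hence "Im (P m (1/4)) = 0" using has_sum_0_simp has_sum_unique by (metis has_sum_0)
      then show ?thesis by (simp add: complex_is_Real_iff)
    qed
    moreover have "Re (P m (1/4)) \<ge> 0"
      using calculation(1) by (rule has_sum_nonneg) (use w in auto)
    ultimately show ?thesis by (simp add: in_Reals_norm complex_is_Real_iff)
  qed
  have u: "u summable_on UNIV \<times> UNIV"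
  proof (rule summable_on_SigmaI[OF _ P])
    show "((\<lambda>r. u (m, r)) has_sum norm (P m (1/4)) / ?n m ^ p) UNIV" for m
      using has_sum_cmult_left[OF wgf[of m], of "1 / ?n m ^ p"] by (simp add: u_def)
  qed (use u0 in auto)
  have v: "v summable_on UNIV"
    unfolding v_def by (rule even_binomial_geometric_has_sum(1)[OF XY])
  have uv: "(\<lambda>(a, b). u a * v b) summable_on UNIV \<times> UNIV"
  proof (rule summable_on_SigmaI)
    show "((\<lambda>b. case (a, b) of (a, b) \<Rightarrow> u a * v b) has_sum u a * infsum v UNIV) UNIV" for a
      using v by (auto intro!: has_sum_cmult_right)
    show "(\<lambda>a. u a * infsum v UNIV) summable_on UNIV"
      using u by (intro summable_on_cmult_left) simp
  qed (use u0 v0 in auto)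
  \<comment> \<open>Since m + 1 >= 1, dropping the power with exponent \<open>b\<close> only
    enlarges the term. This decouples \<open>m\<close> from \<open>b\<close> and makes the majorant
    a product.\<close>
  have pw: "?n m ^ p \<le> ?n m ^ (b + p)" for m b by (intro power_increasing) auto
  have norm_G: "norm (G a) \<le> (case a of (a, b) \<Rightarrow> u a * v b)" for a
  proof -
    obtain m r b j where a: "a = ((m, r), (b, j))" by (metis surj_pair)
    have "norm (G a) = w m r / ?n m ^ (b + p) * norm y ^ r * v (b, j)"
      using w[of m r] by (simp add: a G_def v_def norm_mult norm_power norm_divide del: of_nat_Suc)
    also have "\<dots> \<le> w m r / ?n m ^ p * (1/4) ^ r * v (b, j)"
      using y w pw by (intro mult_right_mono mult_mono power_mono frac_le v0) auto
    finally show ?thesis by (simp add: a u_def)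
  qed
  have G: "G summable_on UNIV \<times> UNIV"
    by (rule abs_summable_summable, rule Infinite_Sum.abs_summable_on_comparison_test'[OF uv norm_G])
  define I where "I = infsum G (UNIV \<times> UNIV)"
  have GI: "(G has_sum I) (UNIV \<times> UNIV)" using G by (simp add: I_def)
  define K where "K = (\<lambda>m. (1 / (1 - (X + Y) / ?c m) + 1 / (1 - (X - Y) / ?c m)) / 2)"
  \<comment> \<open>First grouping: sum over (b, j), then over \<open>r\<close>, which leaves the
    single series \<open>S\<close>.\<close>
  have "((\<lambda>(m, r). of_real (w m r) * y ^ r * (K m / ?c m ^ p)) has_sum I) (UNIV \<times> UNIV)"
    unfolding UNIV_Times_UNIV[where 'a = nat and 'b = nat]
  proof (rule has_sum_SigmaD[OF GI])
    fix mr :: "nat \<times> nat"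
    obtain m r where mr: "mr = (m, r)" by force
    have le: "norm X / ?n m + norm Y / ?n m < 1"
    proof -
      have "norm X / ?n m + norm Y / ?n m \<le> norm X / 1 + norm Y / 1"
        by (intro add_mono divide_left_mono) auto
      with XY show ?thesis by simp
    qed
    have "((\<lambda>(b, j). of_nat (b choose (2 * j)) * (X / ?c m) ^ (b - 2 * j) * (Y / ?c m) ^ (2 * j)) has_sum K m) UNIV"
      using even_binomial_geometric_has_sum(2)[of "X / ?c m" "Y / ?c m"] le
      by (simp add: K_def norm_divide add_divide_distrib diff_divide_distrib del: of_nat_Suc)
    from has_sum_cmult_right[OF this, of "of_real (w m r) * y ^ r / ?c m ^ p"]
    have "((\<lambda>(b, j). of_real (w m r) * y ^ r / ?c m ^ p * (of_nat (b choose (2 * j)) * (X / ?c m) ^ (b - 2 * j) * (Y / ?c m) ^ (2 * j))) has_sum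
        of_real (w m r) * y ^ r * (K m / ?c m ^ p)) UNIV"
      by (simp add: case_prod_unfold)
    also have "(\<lambda>(b, j). of_real (w m r) * y ^ r / ?c m ^ p * (of_nat (b choose (2 * j)) * (X / ?c m) ^ (b - 2 * j) * (Y / ?c m) ^ (2 * j))) =
        (\<lambda>bj. G ((m, r), bj))"
    proof (rule ext, clarify)
      fix b j
      show "of_real (w m r) * y ^ r / ?c m ^ p * (of_nat (b choose (2 * j)) * (X / ?c m) ^ (b - 2 * j) * (Y / ?c m) ^ (2 * j)) = G ((m, r), (b, j))"
      proof (cases "2 * j \<le> b")
        case True
        then have "?c m ^ b = ?c m ^ (b - 2 * j) * ?c m ^ (2 * j)" by (simp flip: power_add)
        then show ?thesis
          by (simp add: G_def power_divide power_add mult_ac del: of_nat_Suc)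
      qed (simp add: G_def binomial_eq_0)
    qed
    finally show "((\<lambda>bj. G (mr, bj)) has_sum (case mr of (m, r) \<Rightarrow> of_real (w m r) * y ^ r * (K m / ?c m ^ p))) UNIV"
      by (simp add: mr)
  qed
  then have "((\<lambda>m. P m y * (K m / ?c m ^ p)) has_sum I) UNIV"
    by (rule has_sum_SigmaD) (unfold prod.case, rule has_sum_cmult_left[OF gf])
  also have "(\<lambda>m. P m y * (K m / ?c m ^ p)) = S"
    by (rule ext) (simp add: S_def K_def y_def)
  finally have SI: "(S has_sum I) UNIV" .
  then show "S summable_on UNIV" by (rule has_sum_imp_summable)

  define G' where "G' = (\<lambda>((i, j), (r, m)). of_real (w m r / ?n m ^ (i + 2 * j - r + p)) *
      ((-2) ^ r * of_nat ((i + 2 * j - r) choose (2 * j)) * X ^ i * Y ^ (2 * j)))"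
  have yp: "y ^ r = (-2) ^ r * X ^ r" for r by (simp only: y_def power_mult_distrib)
  have Xp: "X ^ (b + r - 2 * j) = X ^ (b - 2 * j) * X ^ r" if "2 * j \<le> b" for b r j :: nat
    using that by (simp flip: power_add)
  \<comment> \<open>Second grouping. Where 2j > b the binomial coefficient is 0. On the rest no
    subtraction truncates, and i = b - 2j + r, subject to r <= i, determines b = i + 2j - r.\<close>
  have "(G has_sum I) (UNIV \<times> UNIV) \<longleftrightarrow> (G has_sum I) (UNIV \<times> {(b, j). 2 * j \<le> b})"
    by (rule has_sum_cong_neutral) (auto simp: G_def)
  also have "\<dots> \<longleftrightarrow> (G' has_sum I) (SIGMA (i, j):UNIV. {..i} \<times> UNIV)"
    by (rule has_sum_reindex_bij_witness[of _ "\<lambda>((i, j), (r, m)). ((m, r), (i + 2 * j - r, j))"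
              "\<lambda>((m, r), (b, j)). ((b - 2 * j + r, j), (r, m))"])
       (auto simp: G_def G'_def yp Xp)
  finally have G'I: "(G' has_sum I) (SIGMA (i, j):UNIV. {..i} \<times> UNIV)" using GI by simp
  \<comment> \<open>This supplies the premise of \<open>C\<close>: for fixed \<open>r\<close> it is
    a slice of the summable family \<open>u\<close>, with the factor (1/4)^r undone.\<close>
  have wsum: "(\<lambda>m. w m r / ?n m ^ (b + p)) summable_on UNIV" for b r
  proof -
    have "(\<lambda>m. u (m, r)) summable_on UNIV"
      using u summable_on_SigmaD1[of "\<lambda>r m. u (m, r)" UNIV "\<lambda>_. UNIV" r]
      by (subst (asm) summable_on_swap) (simp add: case_prod_unfold)
    hence "(\<lambda>m. u (m, r) * 4 ^ r) summable_on UNIV" by (rule summable_on_cmult_left)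
    then show ?thesis
    proof (rule summable_on_comparison_test)
      fix m
      have "w m r / ?n m ^ (b + p) \<le> w m r / ?n m ^ p"
        using w pw by (intro divide_left_mono) auto
      then show "w m r / ?n m ^ (b + p) \<le> u (m, r) * 4 ^ r" by (simp add: u_def power_divide del: of_nat_Suc)
    qed (use w in auto)
  qed
  have inner: "((\<lambda>rm. G' (ij, rm)) has_sum T ij) (case ij of (i, j) \<Rightarrow> {..i} \<times> UNIV)" for ij
  proof -
    obtain i j where ij: "ij = (i, j)" by force
    let ?q = "\<lambda>r. (-2) ^ r * of_nat ((i + 2 * j - r) choose (2 * j)) * X ^ i * Y ^ (2 * j)"
    have "((\<lambda>rm. G' (ij, rm)) has_sum T ij) ({..i} \<times> UNIV)"
    proof (rule has_sum_SigmaI)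
      show "((\<lambda>m. G' (ij, r, m)) has_sum of_real (C (i + 2 * j - r) r) * ?q r) UNIV" for r
        unfolding G'_def ij prod.case
        by (intro has_sum_cmult_left has_sum_of_real C wsum)
      show "((\<lambda>r. of_real (C (i + 2 * j - r) r) * ?q r) has_sum T ij) {..i}"
        by (rule has_sum_finiteI) (simp_all add: T_def ij sum_distrib_left sum_distrib_right mult_ac)
      show "(\<lambda>rm. G' (ij, rm)) summable_on {..i} \<times> UNIV"
        using summable_on_SigmaD1[of "\<lambda>ij rm. G' (ij, rm)" UNIV "\<lambda>(i, j). {..i} \<times> UNIV" ij] has_sum_imp_summable[OF G'I]
        by (simp add: ij case_prod_unfold)
    qed
    then show ?thesis by (simp add: ij)
  qed
  have "(T has_sum I) UNIV"
    by (rule has_sum_SigmaD[OF G'I]) (use inner in auto)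
  moreover have "I = infsum S UNIV" using SI by (simp add: infsumI)
  ultimately show "(T has_sum infsum S UNIV) UNIV" by simp
qed

lemma has_sum_sum:
  fixes f :: "'i \<Rightarrow> 'a \<Rightarrow> 'b :: topological_comm_monoid_add"
  assumes "\<And>i. i \<in> A \<Longrightarrow> (f i has_sum s i) B"
  shows "((\<lambda>x. \<Sum>i\<in>A. f i x) has_sum (\<Sum>i\<in>A. s i)) B"
  using assms by (induction A rule: infinite_finite_induct) (auto intro: has_sum_add)

lemma H_has_sum:
  assumes "(\<lambda>m. H_weight m r / real (Suc m) ^ (b + 2)) summable_on UNIV"
  shows "((\<lambda>m. H_weight m r / real (Suc m) ^ (b + 2)) has_sum H (b + 1) (r + 1)) UNIV"
  using mzv_snoc_has_sum[of "replicate r 1" "b + 2"] assms by (simp add: H_weight_def H_def)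

lemma Z_has_sum:
  assumes "(\<lambda>m. Z_weight m r / real (Suc m) ^ (b + 3)) summable_on UNIV"
  shows "((\<lambda>m. Z_weight m r / real (Suc m) ^ (b + 3)) has_sum Z (b + 3) r) UNIV"
proof -
  have "((\<lambda>m. \<Sum>rs\<in>compositions12 r. 2 ^ count_list rs 1 * (mzv_below rs (Suc m) / real (Suc m) ^ (b + 3))) has_sum
          (\<Sum>rs\<in>compositions12 r. 2 ^ count_list rs 1 * mzv (rs @ [b + 3]))) UNIV"
  proof (intro has_sum_sum has_sum_cmult_right mzv_snoc_has_sum)
    fix rs assume rs: "rs \<in> compositions12 r"
    show "(\<lambda>m. mzv_below rs (Suc m) / real (Suc m) ^ (b + 3)) summable_on UNIV"
    proof (rule summable_on_comparison_test[OF assms])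
      \<comment> \<open>All summands of \<open>Z_weight\<close> are nonnegative and the powers of 2
        are at least 1, so each single composition is dominated by the total.\<close>
      fix m
      have "mzv_below rs (Suc m) \<le> 2 ^ count_list rs 1 * mzv_below rs (Suc m)"
        using mult_right_mono[OF one_le_power[of "2::real"] mzv_below_nonneg] by simp
      also have "\<dots> \<le> Z_weight m r"
        unfolding Z_weight_def using rs
        by (rule member_le_sum) (auto simp: mzv_below_nonneg finite_compositions12)
      finally show "mzv_below rs (Suc m) / real (Suc m) ^ (b + 3) \<le> Z_weight m r / real (Suc m) ^ (b + 3)"
        by (rule divide_right_mono) simp
    qed (simp add: mzv_below_nonneg)
  qed
  then show ?thesis
    by (simp add: Z_weight_def Z_def compositions12_def sum_divide_distrib)
qed

section \<open>Specialization to the closed and open series\<close>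

definition shifted_prod :: "nat \<Rightarrow> complex \<Rightarrow> complex" where
  "shifted_prod m y = (\<Prod>i<m. 1 + y / of_nat (Suc i))"

text \<open>Writing \<open>of_nat (Suc 0)\<close> for 1 presents the product as the case
  \<open>N = 0\<close> of \<open>norm_pochhammer_ratio_le_sqrt\<close>.\<close>

lemma shifted_prod_eq_pochhammer: "shifted_prod m y = pochhammer (of_nat (Suc 0) + y) m / pochhammer (of_nat (Suc 0)) m"
proof -
  have "pochhammer (of_nat (Suc 0) + y) m / pochhammer (of_nat (Suc 0)) m = (\<Prod>i<m. (1 + y + of_nat i) / (1 + of_nat i))"
    by (simp add: pochhammer_prod prod_dividef atLeast0LessThan)
  also have "\<dots> = shifted_prod m y"
    unfolding shifted_prod_def
  proof (intro prod.cong refl)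
    fix i
    have "(1 + of_nat i :: complex) \<noteq> 0" by (metis of_nat_Suc of_nat_eq_0_iff nat.distinct(1))
    then show "(1 + y + of_nat i) / (1 + of_nat i) = 1 + y / of_nat (Suc i)" by (simp add: field_simps)
  qed
  finally show ?thesis ..
qed

lemma norm_shifted_prod_le: "norm y \<le> 1/4 \<Longrightarrow> norm (shifted_prod m y) \<le> sqrt (real (Suc m))"
  unfolding shifted_prod_eq_pochhammer by (rule norm_pochhammer_ratio_le_sqrt)

lemma pochhammer_Suc_over_fact: "pochhammer y (Suc m) / fact (Suc m) = y / of_nat (Suc m) * shifted_prod m y"
proof -
  have "pochhammer (of_nat (Suc 0)) m = (fact m :: complex)" by (simp add: pochhammer_fact)
  then show ?thesis by (simp add: shifted_prod_eq_pochhammer pochhammer_rec add.commute del: of_nat_Suc) (simp add: add.commute)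
qed

lemma pochhammer_shift_ratio:
  assumes "norm (b :: complex) \<le> 1/4"
  shows "pochhammer b (Suc m) / pochhammer (1 + b) (Suc m) = b / (of_nat (Suc m) + b)"
proof -
  have "pochhammer (1 + b) m \<noteq> 0"
    using pochhammer_eq_0_imp_Re_nonpos[of "1 + b" m] abs_Re_le_quarter[OF assms] by auto
  then show ?thesis
    unfolding pochhammer_rec[of b] pochhammer_Suc[of "1 + b"] by (simp add: add_ac)
qed

text \<open>The shape shared by \<open>gam\<close> and \<open>eta\<close> up to a scalar. The
  exponent of Y is 2j; that of X is \<open>i\<close> in the closed case and i - 1 in the open
  case.\<close>

definition series_coeff :: "(nat \<Rightarrow> nat \<Rightarrow> real) \<Rightarrow> nat \<Rightarrow> nat \<Rightarrow> real" where
  "series_coeff C i j = (\<Sum>r\<le>i. (-2) ^ r * real ((i + 2 * j - r) choose (2 * j)) * C (i + 2 * j - r) r)"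

definition C_cl where "C_cl b r = Z (b + 3) r"
definition C_op where "C_op b r = H (b + 1) (r + 1)"

definition S_cl :: "complex \<Rightarrow> complex \<Rightarrow> nat \<Rightarrow> complex" where
  "S_cl X Y m = shifted_prod m (-2 * X) ^ 2 / of_nat (Suc m) ^ 3 *
     ((1 / (1 - (X + Y) / of_nat (Suc m)) + 1 / (1 - (X - Y) / of_nat (Suc m))) / 2)"

definition S_op :: "complex \<Rightarrow> complex \<Rightarrow> nat \<Rightarrow> complex" where
  "S_op X Y m = shifted_prod m (-2 * X) / of_nat (Suc m) ^ 2 *
     ((1 / (1 - (X + Y) / of_nat (Suc m)) + 1 / (1 - (X - Y) / of_nat (Suc m))) / 2)"

lemma series_coeff_cl_has_sum:
  assumes "norm X < 1/8" "norm Y < 1/8"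
  shows "((\<lambda>(i, j). of_real (series_coeff C_cl i j) * X ^ i * Y ^ (2 * j)) has_sum infsum (S_cl X Y) UNIV) UNIV"
    and "S_cl X Y summable_on UNIV"
proof -
  have "(\<lambda>m. norm (shifted_prod m (1/4) ^ 2) / real (Suc m) ^ 3) summable_on UNIV"
  proof (rule summable_on_comparison_test)
    have "summable (\<lambda>m. 1 / real (Suc m) ^ 2)"
      using inverse_power_summable[of 2, where 'a = real]
      by (subst summable_Suc_iff) (simp add: field_simps)
    then show "(\<lambda>m. 1 / real (Suc m) ^ 2) summable_on UNIV"
      by (rule summable_nonneg_imp_summable_on) simp
    fix m
    have "norm (shifted_prod m (1/4) ^ 2) \<le> sqrt (real (Suc m)) ^ 2"
      unfolding norm_power by (intro power_mono norm_shifted_prod_le) auto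
    also have "\<dots> = real (Suc m)" by simp
    finally have "norm (shifted_prod m (1/4) ^ 2) / real (Suc m) ^ 3 \<le> real (Suc m) / real (Suc m) ^ 3"
      by (rule divide_right_mono) simp
    also have "\<dots> = 1 / real (Suc m) ^ 2" by (simp add: power2_eq_square power3_eq_cube)
    finally show "norm (shifted_prod m (1/4) ^ 2) / real (Suc m) ^ 3 \<le> 1 / real (Suc m) ^ 2" .
  qed simp
  note * = double_generating_function[of Z_weight "\<lambda>m y. shifted_prod m y ^ 2" 3 C_cl X Y,
      OF Z_weight_nonneg Z_weight_has_sum[folded shifted_prod_def] this Z_has_sum[folded C_cl_def] assms]
  show "((\<lambda>(i, j). of_real (series_coeff C_cl i j) * X ^ i * Y ^ (2 * j)) has_sum infsum (S_cl X Y) UNIV) UNIV"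
    using *(1) unfolding series_coeff_def S_cl_def[abs_def] .
  show "S_cl X Y summable_on UNIV"
    using *(2) unfolding S_cl_def[abs_def] .
qed

lemma series_coeff_op_has_sum:
  assumes "norm X < 1/8" "norm Y < 1/8"
  shows "((\<lambda>(i, j). of_real (series_coeff C_op i j) * X ^ i * Y ^ (2 * j)) has_sum infsum (S_op X Y) UNIV) UNIV"
    and "S_op X Y summable_on UNIV"
proof -
  have "(\<lambda>m. norm (shifted_prod m (1/4)) / real (Suc m) ^ 2) summable_on UNIV"
  proof (rule summable_on_comparison_test)
    show "(\<lambda>m. sqrt (real (Suc m)) / real (Suc m) ^ 2) summable_on UNIV"
      by (rule summable_nonneg_imp_summable_on[OF summable_sqrt_over_square]) simp
    show "norm (shifted_prod m (1/4)) / real (Suc m) ^ 2 \<le> sqrt (real (Suc m)) / real (Suc m) ^ 2" for m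
      by (intro divide_right_mono norm_shifted_prod_le) auto
  qed simp
  note * = double_generating_function[of H_weight shifted_prod 2 C_op X Y,
      OF H_weight_nonneg H_weight_has_sum[folded shifted_prod_def] this H_has_sum[folded C_op_def] assms]
  show "((\<lambda>(i, j). of_real (series_coeff C_op i j) * X ^ i * Y ^ (2 * j)) has_sum infsum (S_op X Y) UNIV) UNIV"
    using *(1) unfolding series_coeff_def S_op_def[abs_def] .
  show "S_op X Y summable_on UNIV"
    using *(2) unfolding S_op_def[abs_def] .
qed

text \<open>The substitution n = i + j + 2, k = j + 1 gives n - k - 1 = i and 2k - 2 = 2j; the
  factor 4 is the surplus (-2)^2.\<close>

lemma gam_eq_series_coeff: "gam (i + j + 2) (j + 1) = 4 * series_coeff C_cl i j"
  unfolding gam_def series_coeff_def sum_distrib_left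
proof (rule sum.cong)
  fix r assume "r \<in> {..i}"
  then have "i + j + 2 + (j + 1) - r - 3 = i + 2 * j - r" "j + 1 + (i + j + 2) - r = i + 2 * j - r + 3"
    by auto
  then show "(-2) ^ (r + 2) * real ((i + j + 2 + (j + 1) - r - 3) choose (2 * (j + 1) - 2)) * Z (j + 1 + (i + j + 2) - r) r =
        4 * ((-2) ^ r * real ((i + 2 * j - r) choose (2 * j)) * C_cl (i + 2 * j - r) r)"
    by (simp add: C_cl_def)
qed auto

text \<open>Here n = i + j + 1, k = j + 1 and s = r + 1, so one factor -2 is left over and the
  exponent of X is i - 1. The resulting 1/X is pulled out of the whole series in
  \<open>op_term_has_sum\<close>.\<close>

lemma eta_eq_series_coeff: "eta (i + j + 1) (j + 1) = -2 * series_coeff C_op i j"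
proof -
  have "eta (i + j + 1) (j + 1) = (\<Sum>r = 0..i.
     (-2) ^ Suc r * real ((j + 1 + (i + j + 1) - Suc r - 1) choose (2 * (j + 1) - 2)) * H (j + 1 + (i + j + 1) - Suc r) (Suc r))"
  proof -
    have e: "i + j + 1 - (j + 1) + 1 = Suc i" by simp
    show ?thesis unfolding eta_def e unfolding One_nat_def sum.shift_bounds_cl_Suc_ivl ..
  qed
  also have "\<dots> = -2 * series_coeff C_op i j"
    unfolding series_coeff_def sum_distrib_left
  proof (rule sum.cong)
    fix r assume "r \<in> {..i}"
    then have "j + 1 + (i + j + 1) - Suc r - 1 = i + 2 * j - r" "j + 1 + (i + j + 1) - Suc r = i + 2 * j - r + 1"
      by auto
    then show "(-2) ^ Suc r * real ((j + 1 + (i + j + 1) - Suc r - 1) choose (2 * (j + 1) - 2)) * H (j + 1 + (i + j + 1) - Suc r) (Suc r) =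
          -2 * ((-2) ^ r * real ((i + 2 * j - r) choose (2 * j)) * C_op (i + 2 * j - r) r)"
      by (simp add: C_op_def)
  qed auto
  finally show ?thesis .
qed

lemma cl_term_has_sum:
  assumes "norm X < 1/8" "norm Y < 1/8"
  shows "(cl_term X Y has_sum 4 * infsum (S_cl X Y) UNIV) cl_index"
proof -
  have "((\<lambda>(i, j). 4 * (of_real (series_coeff C_cl i j) * X ^ i * Y ^ (2 * j))) has_sum 4 * infsum (S_cl X Y) UNIV) UNIV"
    using has_sum_cmult_right[OF series_coeff_cl_has_sum(1)[OF assms], of 4] by (simp add: case_prod_unfold)
  also have "?this \<longleftrightarrow> ?thesis"
  proof (rule has_sum_reindex_bij_witness[of _ "\<lambda>(n, k). (n - k - 1, k - 1)" "\<lambda>(i, j). (i + j + 2, j + 1)"])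
    fix ij :: "nat \<times> nat"
    show "cl_term X Y (case ij of (i, j) \<Rightarrow> (i + j + 2, j + 1)) = (case ij of (i, j) \<Rightarrow> 4 * (of_real (series_coeff C_cl i j) * X ^ i * Y ^ (2 * j)))"
      using gam_eq_series_coeff[of "fst ij" "snd ij"] by (auto simp: cl_term_def case_prod_unfold)
  qed (auto simp: cl_index_def)
  finally show ?thesis .
qed

lemma op_term_has_sum:
  assumes "norm X < 1/8" "norm Y < 1/8" and X: "X \<noteq> 0"
  shows "(op_term X Y has_sum (-2 / X * infsum (S_op X Y) UNIV)) op_index"
proof -
  have "((\<lambda>(i, j). -2 / X * (of_real (series_coeff C_op i j) * X ^ i * Y ^ (2 * j))) has_sum -2 / X * infsum (S_op X Y) UNIV) UNIV"
    using has_sum_cmult_right[OF series_coeff_op_has_sum(1)[OF assms(1,2)], of "-2 / X"] by (simp add: case_prod_unfold)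
  also have "?this \<longleftrightarrow> ?thesis"
  proof (rule has_sum_reindex_bij_witness[of _ "\<lambda>(n, k). (n - k, k - 1)" "\<lambda>(i, j). (i + j + 1, j + 1)"])
    fix ij :: "nat \<times> nat"
    obtain i j where ij: "ij = (i, j)" by force
    have "X powi (int (i + j + 1) - int (j + 1) - 1) = X powi (int i - 1)" by simp
    also have "\<dots> = X ^ i / X" using X by (simp add: power_int_diff)
    finally have p: "X powi (int (i + j + 1) - int (j + 1) - 1) = X ^ i / X" .
    show "op_term X Y (case ij of (i, j) \<Rightarrow> (i + j + 1, j + 1)) = (case ij of (i, j) \<Rightarrow> -2 / X * (of_real (series_coeff C_op i j) * X ^ i * Y ^ (2 * j)))"
      unfolding op_term_def ij prod.case p eta_eq_series_coeff by simp
  qed (auto simp: op_index_def)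
  finally show ?thesis .
qed

section \<open>Closed forms\<close>

text \<open>This is the Gauss series without its term of index 0. The quotient of shifted Pochhammer
  symbols telescopes to -x/(n - x), the other one is y/n times \<open>shifted_prod\<close>, and
  dividing by -xy leaves the summand.\<close>

lemma gauss_sums_tail:
  fixes x y :: complex
  assumes x: "norm x \<le> 1/4" and y: "norm y \<le> 1/4" and nz: "x \<noteq> 0" "y \<noteq> 0"
  shows "(\<lambda>m. shifted_prod m y / (of_nat (Suc m) * (of_nat (Suc m) - x))) sums
          ((1 - rGamma (1 - x - y) / (rGamma (1 - x) * rGamma (1 - y))) / (x * y))"
proof -
  define u where "u = (\<lambda>n. pochhammer (- x) n * pochhammer y n / (fact n * pochhammer (1 - x) n))"
  note g = gauss_summation_special[OF x y, folded u_def]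
  have Re: "\<bar>Re x\<bar> \<le> 1/4" "\<bar>Re y\<bar> \<le> 1/4" using x y abs_Re_le_quarter by blast+
  have R: "rGamma (1 - x) \<noteq> 0" "rGamma (1 - y) \<noteq> 0"
    using Re Re_pos_not_nonpos_Int[of "1 - x"] Re_pos_not_nonpos_Int[of "1 - y"] by (auto simp: rGamma_eq_zero_iff)
  have "u sums suminf u" using g(1) by (rule summable_sums)
  hence "(\<lambda>m. u (Suc m)) sums (suminf u - u 0)" by (subst sums_Suc_iff) simp
  hence "(\<lambda>m. u (Suc m) * (-1 / (x * y))) sums ((suminf u - u 0) * (-1 / (x * y)))" by (rule sums_mult2)
  also have "(\<lambda>m. u (Suc m) * (-1 / (x * y))) = (\<lambda>m. shifted_prod m y / (of_nat (Suc m) * (of_nat (Suc m) - x)))"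
  proof
    fix m
    have "u (Suc m) = (pochhammer (-x) (Suc m) / pochhammer (1 + (-x)) (Suc m)) * (pochhammer y (Suc m) / fact (Suc m))"
      by (simp add: u_def)
    also have "\<dots> = (-x / (of_nat (Suc m) + (-x))) * (y / of_nat (Suc m) * shifted_prod m y)"
      using x by (subst pochhammer_shift_ratio, simp, subst pochhammer_Suc_over_fact) (rule refl)
    finally show "u (Suc m) * (-1 / (x * y)) = shifted_prod m y / (of_nat (Suc m) * (of_nat (Suc m) - x))"
      using nz by (simp del: of_nat_Suc)
  qed
  also have "(suminf u - u 0) * (-1 / (x * y)) = (1 - suminf u) / (x * y)"
    using nz by (simp add: u_def field_simps)
  also have "suminf u = rGamma (1 - x - y) / (rGamma (1 - x) * rGamma (1 - y))"
    using g(2) R by (simp add: field_simps)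
  finally show ?thesis .
qed

text \<open>With A = X + Y and B = X - Y, Gauss's sum is taken at x = A and at x = B with y = -2X.
  Since A + B = 2X, the parameter 1 - x - y becomes 1 + B and 1 + A respectively.\<close>

lemma W_op_eq:
  assumes X: "norm X < 1/16" and Y: "norm Y < 1/16" and nz: "X \<noteq> 0" "X + Y \<noteq> 0" "X - Y \<noteq> 0"
  shows "W_op X Y = - (rGamma (1 + (X - Y)) / ((X + Y) * rGamma (1 - (X + Y))) + rGamma (1 + (X + Y)) / ((X - Y) * rGamma (1 - (X - Y)))) /
           (2 * X ^ 2 * rGamma (1 + 2 * X))"
proof -
  define A where "A = X + Y"
  define B where "B = X - Y"
  have XAB: "2 * X = A + B" by (simp add: A_def B_def)
  have nzAB: "A \<noteq> 0" "B \<noteq> 0" "A + B \<noteq> 0" using nz XAB[symmetric] by (auto simp: A_def B_def)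
  have AB: "norm A \<le> 1/4" "norm B \<le> 1/4" "norm (-2 * X) \<le> 1/4"
    using X Y norm_triangle_ineq[of X Y] norm_triangle_ineq4[of X Y]
    by (auto simp: A_def B_def norm_mult)
  have y: "-2 * X \<noteq> 0" using nz by simp
  have R: "rGamma (1 - A) \<noteq> 0" "rGamma (1 - B) \<noteq> 0" "rGamma (1 + 2 * X) \<noteq> 0"
    using abs_Re_le_quarter[OF AB(1)] abs_Re_le_quarter[OF AB(2)] abs_Re_le_quarter[OF AB(3)]
      Re_pos_not_nonpos_Int[of "1 - A"] Re_pos_not_nonpos_Int[of "1 - B"] Re_pos_not_nonpos_Int[of "1 + 2 * X"]
    by (auto simp: rGamma_eq_zero_iff)
  define gA where "gA = rGamma (1 + B) / (rGamma (1 - A) * rGamma (1 + 2 * X))"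
  define gB where "gB = rGamma (1 + A) / (rGamma (1 - B) * rGamma (1 + 2 * X))"
  have e: "1 - A - (-2 * X) = 1 + B" "1 - B - (-2 * X) = 1 + A" "1 - (-2 * X) = 1 + 2 * X"
    by (simp_all add: A_def B_def)
  have sA: "(\<lambda>m. shifted_prod m (-2 * X) / (of_nat (Suc m) * (of_nat (Suc m) - A))) sums ((1 - gA) / (A * (-2 * X)))"
    using gauss_sums_tail[OF AB(1) AB(3) nzAB(1) y] unfolding e gA_def .
  have sB: "(\<lambda>m. shifted_prod m (-2 * X) / (of_nat (Suc m) * (of_nat (Suc m) - B))) sums ((1 - gB) / (B * (-2 * X)))"
    using gauss_sums_tail[OF AB(2) AB(3) nzAB(2) y] unfolding e gB_def .
  have "(\<lambda>m. (shifted_prod m (-2 * X) / (of_nat (Suc m) * (of_nat (Suc m) - A)) + shifted_prod m (-2 * X) / (of_nat (Suc m) * (of_nat (Suc m) - B))) * (1 / 2))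
      sums (((1 - gA) / (A * (-2 * X)) + (1 - gB) / (B * (-2 * X))) * (1 / 2))"
    by (intro sums_mult2 sums_add sA sB)
  also have "(\<lambda>m. (shifted_prod m (-2 * X) / (of_nat (Suc m) * (of_nat (Suc m) - A)) + shifted_prod m (-2 * X) / (of_nat (Suc m) * (of_nat (Suc m) - B))) * (1 / 2)) = S_op X Y"
  proof
    fix m
    have *: "1 / (1 - c / of_nat (Suc m)) = of_nat (Suc m) / (of_nat (Suc m) - c)" for c :: complex
      by (simp add: divide_simps del: of_nat_Suc)
    have aux: "(q / (n * a) + q / (n * b)) * (1 / 2) = q / n ^ 2 * ((n / a + n / b) / 2)"
      if "n \<noteq> 0" for q n a b :: complex
      using that by (simp add: power2_eq_square distrib_left add_divide_distrib mult_ac)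
    show "(shifted_prod m (-2 * X) / (of_nat (Suc m) * (of_nat (Suc m) - A)) + shifted_prod m (-2 * X) / (of_nat (Suc m) * (of_nat (Suc m) - B))) * (1 / 2) = S_op X Y m"
      unfolding S_op_def A_def[symmetric] B_def[symmetric] * by (rule aux) (simp del: of_nat_Suc)
  qed
  finally have "S_op X Y sums (((1 - gA) / (A * (-2 * X)) + (1 - gB) / (B * (-2 * X))) * (1 / 2))" .
  moreover have "S_op X Y sums infsum (S_op X Y) UNIV"
    using series_coeff_op_has_sum(2)[of X Y] X Y by (intro has_sum_imp_sums has_sum_infsum) auto
  ultimately have S: "infsum (S_op X Y) UNIV = ((1 - gA) / (A * (-2 * X)) + (1 - gB) / (B * (-2 * X))) * (1 / 2)"
    by (rule sums_unique2[symmetric])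
  have "W_op X Y = 1 / (X * A * (-B)) - 2 / X * (((1 - gA) / (A * (-2 * X)) + (1 - gB) / (B * (-2 * X))) * (1 / 2))"
    unfolding W_op_def using infsumI[OF op_term_has_sum[of X Y]] X Y nz(1) S
    by (simp add: A_def B_def)
  also have "\<dots> = - (gA / A + gB / B) / (2 * X ^ 2)"
    \<comment> \<open>The constants 1 in 1 - gA and 1 - gB add up to 1/(XAB), because A + B = 2X,
      and cancel the polar term.\<close>
    using nzAB nz(1) by (simp add: divide_simps power2_eq_square) (use XAB in algebra)
  also have "\<dots> = - (rGamma (1 + B) / (A * rGamma (1 - A)) + rGamma (1 + A) / (B * rGamma (1 - B))) / (2 * X ^ 2 * rGamma (1 + 2 * X))"
  proof -
    have aux: "- (p / r + q / r) / c = - (p + q) / (c * r)" for p q r c :: complex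
      by (simp add: add_divide_distrib diff_divide_distrib mult.commute)
    have "gA / A = rGamma (1 + B) / (A * rGamma (1 - A)) / rGamma (1 + 2 * X)"
         "gB / B = rGamma (1 + A) / (B * rGamma (1 - B)) / rGamma (1 + 2 * X)"
      by (simp_all add: gA_def gB_def mult_ac)
    then show ?thesis by (simp only: aux)
  qed
  finally show ?thesis by (simp add: A_def B_def)
qed

text \<open>The well-poised series is used with b = -A, c = -B, d = -2X. Without its term of index 0
  and scaled by -1/(4XAB) it is the sum of \<open>S_cl\<close>; the polar term of
  \<open>W_cl\<close> restores the missing term, and a single Gamma quotient remains.\<close>

lemma W_cl_eq:
  assumes X: "norm X < 1/16" and Y: "norm Y < 1/16" and nz: "X \<noteq> 0" "X + Y \<noteq> 0" "X - Y \<noteq> 0"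
  shows "W_cl X Y = - (rGamma (1 - 2 * X) * rGamma (1 + (X + Y)) * rGamma (1 + (X - Y))) /
            (X * (X + Y) * (X - Y) * (rGamma (1 - (X + Y)) * rGamma (1 - (X - Y)) * rGamma (1 + 2 * X)))"
proof -
  define A where "A = X + Y"
  define B where "B = X - Y"
  define d where "d = -2 * X"
  have XAB: "2 * X = A + B" by (simp add: A_def B_def)
  have nzAB: "A \<noteq> 0" "B \<noteq> 0" "d \<noteq> 0" using nz by (auto simp: A_def B_def d_def)
  have AB: "norm (-A) \<le> 1/4" "norm (-B) \<le> 1/4" "norm d \<le> 1/4"
    unfolding norm_minus_cancel using X Y norm_triangle_ineq[of X Y] norm_triangle_ineq4[of X Y]
    by (auto simp: A_def B_def d_def norm_mult)
  have R: "rGamma (1 - A) \<noteq> 0" "rGamma (1 - B) \<noteq> 0" "rGamma (1 + 2 * X) \<noteq> 0"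
    using abs_Re_le_quarter[OF AB(1)] abs_Re_le_quarter[OF AB(2)] abs_Re_le_quarter[OF AB(3)]
      Re_pos_not_nonpos_Int[of "1 - A"] Re_pos_not_nonpos_Int[of "1 - B"] Re_pos_not_nonpos_Int[of "1 + 2 * X"]
    by (auto simp: rGamma_eq_zero_iff d_def)
  have Re: "\<bar>Re (-A)\<bar> \<le> 1/4" "\<bar>Re (-B)\<bar> \<le> 1/4" using AB abs_Re_le_quarter by blast+
  define u where "u = (\<lambda>n. (d + 2 * of_nat n) * pochhammer d n / d * pochhammer (-A) n * pochhammer (-B) n * pochhammer d n /
             (fact n * fact n * pochhammer (1 + -A) n * pochhammer (1 + -B) n))"
  have "d = -A + -B" by (simp add: d_def A_def B_def)
  note g = well_poised_summation_special[OF AB this nzAB(3), folded u_def]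
  define G where "G = rGamma (1 - 2 * X) * rGamma (1 + A) * rGamma (1 + B) / (rGamma (1 - A) * rGamma (1 - B) * rGamma (1 + 2 * X))"
  have G: "suminf u = G" using g(2) R by (simp add: G_def d_def field_simps)
  have "u sums suminf u" using g(1) by (rule summable_sums)
  hence "(\<lambda>m. u (Suc m)) sums (suminf u - u 0)" by (subst sums_Suc_iff) simp
  hence "(\<lambda>m. u (Suc m) * (-1 / (4 * X * A * B))) sums ((suminf u - u 0) * (-1 / (4 * X * A * B)))" by (rule sums_mult2)
  also have "(\<lambda>m. u (Suc m) * (-1 / (4 * X * A * B))) = S_cl X Y"
  proof
    fix m
    define n :: complex where "n = of_nat (Suc m)"
    have n: "n \<noteq> 0" unfolding n_def by (simp del: of_nat_Suc)
    have "n - A \<noteq> 0" "n - B \<noteq> 0"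
    proof -
      have "Re (n - A) > 0" "Re (n - B) > 0" using Re by (auto simp: n_def)
      then show "n - A \<noteq> 0" "n - B \<noteq> 0" by auto
    qed
    note nz' = this n
    have aux: "(2 * s) / d * (-A / a) * (-B / b) * (d / n * q) ^ 2 * (-1 / (4 * X * A * B)) = s * q ^ 2 / (n ^ 2 * a * b)"
      if "n \<noteq> 0" "a \<noteq> 0" "b \<noteq> 0" for n a b s q :: complex
      using that nzAB nz(1) unfolding d_def by (simp add: power2_eq_square divide_simps)
    have "u (Suc m) = (d + 2 * n) / d * (pochhammer (-A) (Suc m) / pochhammer (1 + -A) (Suc m)) *
       (pochhammer (-B) (Suc m) / pochhammer (1 + -B) (Suc m)) * (pochhammer d (Suc m) / fact (Suc m)) ^ 2"
      by (simp add: u_def n_def power2_eq_square mult_ac)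
    also have "\<dots> = (d + 2 * n) / d * (-A / (n + -A)) * (-B / (n + -B)) * (d / n * shifted_prod m d) ^ 2"
      unfolding n_def using AB by (simp only: pochhammer_shift_ratio pochhammer_Suc_over_fact)
    finally have "u (Suc m) * (-1 / (4 * X * A * B)) = (n - X) * shifted_prod m d ^ 2 / (n ^ 2 * (n - A) * (n - B))"
      using aux[of n "n - A" "n - B" "n - X" "shifted_prod m d"] nz' by (simp add: d_def)
    moreover have "S_cl X Y m = (n - X) * shifted_prod m d ^ 2 / (n ^ 2 * (n - A) * (n - B))"
    proof -
      have *: "1 / (1 - c / n) = n / (n - c)" for c
        using n by (simp add: divide_simps)
      \<comment> \<open>As A + B = 2X, the numerator contains 2(n - X) = d + 2n, which is the very
        well-poised factor.\<close>
      have "n / (n - A) + n / (n - B) = n * (2 * n - (A + B)) / ((n - A) * (n - B))"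
        using nz' by (simp add: field_simps)
      also have "\<dots> = n * (2 * (n - X)) / ((n - A) * (n - B))" by (simp add: XAB[symmetric])
      finally have **: "n / (n - A) + n / (n - B) = n * (2 * (n - X)) / ((n - A) * (n - B))" .
      have aux2: "q ^ 2 / n ^ 3 * (n * (2 * s) / c / 2) = s * q ^ 2 / (n ^ 2 * c)" for q s c
        using n by (simp add: power2_eq_square power3_eq_cube mult_ac)
      show ?thesis
        unfolding S_cl_def A_def[symmetric] B_def[symmetric] n_def[symmetric] * ** d_def[symmetric]
        using aux2[of "shifted_prod m d" "n - X" "(n - A) * (n - B)"] n by (simp only: mult.assoc)
    qed
    ultimately show "u (Suc m) * (-1 / (4 * X * A * B)) = S_cl X Y m" by simp
  qed
  finally have "S_cl X Y sums ((G - u 0) * (-1 / (4 * X * A * B)))" unfolding G .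
  moreover have "S_cl X Y sums infsum (S_cl X Y) UNIV"
    using series_coeff_cl_has_sum(2)[of X Y] X Y by (intro has_sum_imp_sums has_sum_infsum) auto
  ultimately have S: "infsum (S_cl X Y) UNIV = (G - 1) * (-1 / (4 * X * A * B))"
    using sums_unique2 nzAB by (fastforce simp: u_def)
  have "W_cl X Y = 1 / (X * A * (-B)) + 4 * ((G - 1) * (-1 / (4 * X * A * B)))"
    unfolding W_cl_def using infsumI[OF cl_term_has_sum[of X Y]] X Y S
    by (simp add: A_def B_def)
  also have "\<dots> = - G / (X * A * B)"
    using nzAB nz(1) by (simp add: divide_simps)
  finally show ?thesis by (simp add: A_def B_def G_def)
qed

section \<open>Reflection formula and the identities at a point\<close>

lemma sin_pi_eq_rGamma:
  fixes z :: complex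
  shows "sin (of_real pi * z) = of_real pi * z * rGamma (1 + z) * rGamma (1 - z)"
proof (cases "z = 0")
  case False
  have "-(z * z) * (rGamma (1 + z) * rGamma (1 - z)) = rGamma z * rGamma (- z)"
    using rGamma_plus1[of z, symmetric] rGamma_plus1[of "-z", symmetric] by (simp add: add.commute)
  also have "\<dots> = - z * sin (of_real pi * z) / of_real pi" by (rule rGamma_reflection_complex')
  finally show ?thesis using False by (simp add: field_simps)
qed simp

lemma rGamma_1_plus_nonzero: "norm (z :: complex) < 1 \<Longrightarrow> rGamma (1 + z) \<noteq> 0"
  using abs_Re_le_cmod[of z] Re_pos_not_nonpos_Int[of "1 + z"] by (auto simp: rGamma_eq_zero_iff)

lemma sin_pi_nonzero:
  assumes "norm (z :: complex) < 1" "z \<noteq> 0" shows "sin (of_real pi * z) \<noteq> 0"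
  unfolding sin_pi_eq_rGamma
  using assms rGamma_1_plus_nonzero[of z] rGamma_1_plus_nonzero[of "-z"] by simp

text \<open>The sum of sines is 2 sin(pi X) cos(pi Y). The cosine has no zero here because sin(2 pi
  Y) is nonzero for small nonzero Y. This makes the denominator of the second identity nonzero, and
  with it the numerator of \<open>W_op\<close>.\<close>

lemma sin_add_sin_pi_nonzero:
  fixes X Y :: complex
  assumes X: "norm X < 1/16" "X \<noteq> 0" and Y: "norm Y < 1/16"
  shows "sin (of_real pi * (X + Y)) + sin (of_real pi * (X - Y)) \<noteq> 0"
proof -
  have "sin (of_real pi * (X + Y)) + sin (of_real pi * (X - Y)) = 2 * sin (of_real pi * X) * cos (of_real pi * Y)"
    by (simp add: distrib_left right_diff_distrib sin_add sin_diff)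
  moreover have "sin (of_real pi * X) \<noteq> 0" using X by (intro sin_pi_nonzero) auto
  moreover have "cos (of_real pi * Y) \<noteq> 0"
  proof (cases "Y = 0")
    case False
    have "sin (of_real pi * (2 * Y)) \<noteq> 0" using False Y by (intro sin_pi_nonzero) (auto simp: norm_mult)
    moreover have "sin (of_real pi * (2 * Y)) = 2 * sin (of_real pi * Y) * cos (of_real pi * Y)"
      using sin_double[of "of_real pi * Y"] by (simp add: mult_ac)
    ultimately show ?thesis by auto
  qed simp
  ultimately show ?thesis by simp
qed

lemma W_identities:
  fixes X Y :: complex
  assumes X: "norm X < 1/16" and Y: "norm Y < 1/16" and nz: "X \<noteq> 0" "X + Y \<noteq> 0" "X - Y \<noteq> 0"
  defines "sA \<equiv> sin (of_real pi * (X + Y))" and "sB \<equiv> sin (of_real pi * (X - Y))"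
  shows "W_op (-X) Y \<noteq> 0"
    and "W_cl X Y = W_op X Y * inverse (W_op (-X) Y) / (X * (X + Y) * (X - Y))"
    and "W_cl X Y = 2 * X ^ 2 / of_real pi * ((sin (2 * of_real pi * X) * sA * sin (of_real pi * (Y - X))) / (sA + sB) ^ 2) * W_op X Y ^ 2"
proof -
  define A where "A = X + Y"
  define B where "B = X - Y"
  define a where "a = rGamma (1 + A)"
  define a' where "a' = rGamma (1 - A)"
  define b where "b = rGamma (1 + B)"
  define b' where "b' = rGamma (1 - B)"
  define c where "c = rGamma (1 + 2 * X)"
  define c' where "c' = rGamma (1 - 2 * X)"
  define \<pi> where "\<pi> = complex_of_real pi"
  have nAB: "norm A < 1" "norm B < 1" "norm (2 * X) < 1"
    using X Y norm_triangle_ineq[of X Y] norm_triangle_ineq4[of X Y] by (auto simp: A_def B_def norm_mult)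
  have nz': "A \<noteq> 0" "B \<noteq> 0" using nz by (auto simp: A_def B_def)
  have pi: "\<pi> \<noteq> 0" by (simp add: \<pi>_def)
  have R: "a \<noteq> 0" "a' \<noteq> 0" "b \<noteq> 0" "b' \<noteq> 0" "c \<noteq> 0" "c' \<noteq> 0"
    using rGamma_1_plus_nonzero[of A] rGamma_1_plus_nonzero[of "-A"] rGamma_1_plus_nonzero[of B]
      rGamma_1_plus_nonzero[of "-B"] rGamma_1_plus_nonzero[of "2*X"] rGamma_1_plus_nonzero[of "-(2*X)"] nAB
    by (simp_all add: a_def a'_def b_def b'_def c_def c'_def)
  have sA: "sA = \<pi> * A * a * a'" by (simp only: sA_def A_def[symmetric] sin_pi_eq_rGamma \<pi>_def a_def a'_def)
  have sB: "sB = \<pi> * B * b * b'" by (simp only: sB_def B_def[symmetric] sin_pi_eq_rGamma \<pi>_def b_def b'_def)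
  have sC: "sin (2 * of_real pi * X) = \<pi> * (2 * X) * c * c'"
    using sin_pi_eq_rGamma[of "2 * X"] by (simp add: \<pi>_def c_def c'_def mult_ac)
  have sB': "sin (of_real pi * (Y - X)) = - sB"
    unfolding sB_def by (simp add: right_diff_distrib flip: sin_minus)
  \<comment> \<open>By reflection, pi times \<open>t\<close> is the sum of the two sines.
    \<open>t\<close> is also, up to sign, the numerator of \<open>W_op\<close> at both
    \<open>X\<close> and \<open>-X\<close>: it cancels in the first identity, and its square cancels
    in the second.\<close>
  define t where "t = A * a * a' + B * b * b'"
  have st: "sA + sB = \<pi> * t" by (simp add: sA sB t_def algebra_simps)
  have t0: "t \<noteq> 0"
    using sin_add_sin_pi_nonzero[OF X nz(1) Y] st unfolding sA_def sB_def by auto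
  have op: "W_op X Y = - t / (2 * X ^ 2 * c * (A * B * a' * b'))"
  proof -
    have "W_op X Y = - (b / (A * a') + a / (B * b')) / (2 * X ^ 2 * c)"
      using W_op_eq[OF X Y nz] by (simp add: A_def B_def a_def a'_def b_def b'_def c_def)
    also have "b / (A * a') + a / (B * b') = t / (A * B * a' * b')"
      using nz' R by (simp add: t_def divide_simps)
    finally show ?thesis by (simp add: mult_ac)
  qed
  \<comment> \<open>Replacing X by -X sends (A, B) to (-B, -A). Hence \<open>a\<close> and
    \<open>b'\<close> are exchanged, as are \<open>b\<close> and \<open>a'\<close>, and
    \<open>t\<close> changes sign.\<close>
  have op': "W_op (-X) Y = t / (2 * X ^ 2 * c' * (A * B * a * b))"
  proof -
    have nA: "-X + Y = - B" "-X - Y = - A" by (simp_all add: A_def B_def)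
    have "W_op (-X) Y = - (rGamma (1 + (-A)) / (- B * rGamma (1 - (-B))) + rGamma (1 + (-B)) / (- A * rGamma (1 - (-A)))) / (2 * (-X) ^ 2 * rGamma (1 + 2 * (-X)))"
      using W_op_eq[of "-X" Y] X Y nz nz' unfolding nA by simp
    also have "\<dots> = (a' / (B * b) + b' / (A * a)) / (2 * X ^ 2 * c')"
      by (simp add: a_def a'_def b_def b'_def c'_def)
    also have "a' / (B * b) + b' / (A * a) = t / (A * B * a * b)"
      using nz' R by (simp add: t_def divide_simps)
    finally show ?thesis by (simp add: mult_ac)
  qed
  have cl: "W_cl X Y = - (c' * a * b) / (X * A * B * (a' * b' * c))"
    using W_cl_eq[OF X Y nz] by (simp add: A_def B_def a_def a'_def b_def b'_def c_def c'_def)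
  show "W_op (-X) Y \<noteq> 0" unfolding op' using t0 nz(1) nz' R by simp
  show "W_cl X Y = W_op X Y * inverse (W_op (-X) Y) / (X * (X + Y) * (X - Y))"
    unfolding op op' cl A_def[symmetric] B_def[symmetric] using t0 nz(1) nz' R
    by (simp add: divide_simps)
  show "W_cl X Y = 2 * X ^ 2 / of_real pi * ((sin (2 * of_real pi * X) * sA * sin (of_real pi * (Y - X))) / (sA + sB) ^ 2) * W_op X Y ^ 2"
    unfolding sB' sC st op cl unfolding \<pi>_def[symmetric] sA sB using t0 nz(1) nz' R pi
    by (simp add: divide_simps power2_eq_square)
qed

section \<open>Meromorphy of the two series and passage from points to germs\<close>

lemma holo_germ_even_snd:
  fixes c :: "nat \<Rightarrow> nat \<Rightarrow> real"
  assumes "\<And>x y. norm x < 1/8 \<Longrightarrow> norm y < 1/8 \<Longrightarrow>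
             ((\<lambda>(i, j). of_real (c i j) * x ^ i * y ^ (2 * j)) has_sum F x y) UNIV"
  shows "holo_germ F"
proof -
  define a where "a = (\<lambda>i j. if even j then complex_of_real (c i (j div 2)) else 0)"
  have "((\<lambda>(i, j). a i j * x ^ i * y ^ j) has_sum F x y) UNIV" if "norm x < 1/8" "norm y < 1/8" for x y
  proof -
    have "((\<lambda>(i, j). of_real (c i j) * x ^ i * y ^ (2 * j)) has_sum F x y) UNIV \<longleftrightarrow>
        ((\<lambda>(i, j). a i j * x ^ i * y ^ j) has_sum F x y) (UNIV \<times> {j. even j})"
      by (rule has_sum_reindex_bij_witness[of _ "\<lambda>(i, j). (i, j div 2)" "\<lambda>(i, j). (i, 2 * j)"])
         (auto simp: a_def)
    also have "\<dots> \<longleftrightarrow> ((\<lambda>(i, j). a i j * x ^ i * y ^ j) has_sum F x y) UNIV"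
      by (rule has_sum_cong_neutral) (auto simp: a_def split: if_splits)
    finally show ?thesis using assms[OF that] by simp
  qed
  then show ?thesis
    unfolding holo_germ_def eventually_nhds_00_iff by (intro exI[of _ a] exI[of _ "1/8"]) auto
qed

text \<open>The denominator of the polar term. It serves both as the denominator that shows the two
  series to be meromorphic and as the exceptional set of the pointwise identities.\<close>

definition lines :: "complex \<Rightarrow> complex \<Rightarrow> complex" where
  "lines x y = x * (x + y) * (y - x)"

text \<open>The right-hand side uses only constants, differences and multiplication by a coordinate,
  the operations for which holomorphic germs have been shown to be closed.\<close>

lemma lines_eq: "lines x y = y * (y * (x * 1)) - x * (x * (x * 1))"
  by (simp add: lines_def algebra_simps)

lemma holo_germ_lines: "holo_germ lines"
proof -
  have "holo_germ (\<lambda>x y. y * (y * (x * 1)) - x * (x * (x * 1)))"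
    by (intro holo_germ_diff holo_germ_mult_fst holo_germ_mult_snd holo_germ_const)
  then show ?thesis by (simp only: lines_eq[symmetric] eta_contract_eq)
qed

lemma nonzero_holo_germ_lines: "nonzero_holo_germ lines"
  unfolding nonzero_holo_germ_def
proof (intro conjI holo_germ_lines notI)
  assume "\<forall>\<^sub>F (x, y) in nhds (0, 0). lines x y = 0"
  then obtain r where r: "r > 0" "\<And>x y. norm x < r \<Longrightarrow> norm y < r \<Longrightarrow> lines x y = 0"
    unfolding eventually_nhds_00_iff by blast
  have "lines (of_real (r / 2)) 0 = 0" using r(1) by (intro r(2)) auto
  then show False using r(1) by (simp add: lines_def)
qed

lemma mero_germ_eqI:
  assumes "\<And>X Y. norm X < 1/16 \<Longrightarrow> norm Y < 1/16 \<Longrightarrow> X \<noteq> 0 \<Longrightarrow> X + Y \<noteq> 0 \<Longrightarrow> X - Y \<noteq> 0 \<Longrightarrow> f X Y = g X Y"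
  shows "mero_germ_eq f g"
  unfolding mero_germ_eq_def eventually_nhds_00_iff
  by (rule exI[of _ lines], rule conjI[OF nonzero_holo_germ_lines], rule exI[of _ "1/16"])
     (use assms in \<open>auto simp: lines_def\<close>)

lemma mero_germ_W_cl: "mero_germ W_cl"
proof -
  define F where "F = (\<lambda>X Y. infsum (S_cl X Y) UNIV)"
  have F: "holo_germ F"
    unfolding F_def by (rule holo_germ_even_snd) (rule series_coeff_cl_has_sum)
  \<comment> \<open>This is 1 + \<open>lines\<close> times 4F, with \<open>lines\<close> multiplied
    out so that the closure rules apply.\<close>
  define g where "g = (\<lambda>x y. 1 + (y * (y * (x * (4 * F x y))) - x * (x * (x * (4 * F x y)))))"
  have "holo_germ g"
    unfolding g_def
    by (intro holo_germ_add holo_germ_const holo_germ_diff holo_germ_mult_fst holo_germ_mult_snd holo_germ_cmult F)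
  moreover have "W_cl X Y = g X Y / lines X Y" if "norm X < 1/8" "norm Y < 1/8" "lines X Y \<noteq> 0" for X Y
  proof -
    have "W_cl X Y = 1 / lines X Y + 4 * F X Y"
      unfolding W_cl_def using infsumI[OF cl_term_has_sum[OF that(1,2)]] by (simp add: F_def lines_def)
    also have "\<dots> = (1 + lines X Y * (4 * F X Y)) / lines X Y" using that(3) by (simp add: add_divide_distrib)
    also have "1 + lines X Y * (4 * F X Y) = g X Y" by (simp add: g_def lines_def algebra_simps)
    finally show ?thesis .
  qed
  ultimately show ?thesis
    unfolding mero_germ_def eventually_nhds_00_iff
    by (intro exI[of _ g] exI[of _ lines] exI[of _ "1/8"] conjI nonzero_holo_germ_lines) auto
qed

lemma mero_germ_W_op: "mero_germ W_op"
proof -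
  define F where "F = (\<lambda>X Y. infsum (S_op X Y) UNIV)"
  have F: "holo_germ F"
    unfolding F_def by (rule holo_germ_even_snd) (rule series_coeff_op_has_sum)
  \<comment> \<open>The factor x of \<open>lines\<close> cancels the 1/X in front of the open
    series, so only y^2 - x^2 multiplies -2F.\<close>
  define g where "g = (\<lambda>x y. 1 + (y * (y * (- 2 * F x y)) - x * (x * (- 2 * F x y))))"
  have "holo_germ g"
    unfolding g_def
    by (intro holo_germ_add holo_germ_const holo_germ_diff holo_germ_mult_fst holo_germ_mult_snd holo_germ_cmult F)
  moreover have "W_op X Y = g X Y / lines X Y" if "norm X < 1/8" "norm Y < 1/8" "lines X Y \<noteq> 0" for X Y
  proof -
    have X: "X \<noteq> 0" using that(3) by (auto simp: lines_def)
    have "W_op X Y = 1 / lines X Y + -2 / X * F X Y"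
      unfolding W_op_def using infsumI[OF op_term_has_sum[OF that(1,2) X]] by (simp add: F_def lines_def)
    also have "\<dots> = (1 + lines X Y * (-2 / X * F X Y)) / lines X Y"
      using nonzero_mult_div_cancel_left[OF that(3)] by (simp only: add_divide_distrib)
    also have "1 + lines X Y * (-2 / X * F X Y) = g X Y" using X by (simp add: g_def lines_def algebra_simps)
    finally show ?thesis .
  qed
  ultimately show ?thesis
    unfolding mero_germ_def eventually_nhds_00_iff
    by (intro exI[of _ g] exI[of _ lines] exI[of _ "1/8"] conjI nonzero_holo_germ_lines) auto
qed

text \<open>This makes the inverse in the first identity that of a nonzero germ, not the default
  \<open>inverse 0 = 0\<close>. Near the origin \<open>W_op (- X) Y\<close> has no zeros off the
  three lines, so if it vanished wherever \<open>h\<close> is nonzero, \<open>h\<close> would vanish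
  off the lines and therefore be the zero germ.\<close>

lemma W_op_neg_germ_nonzero: "\<not> mero_germ_eq (\<lambda>X Y. W_op (- X) Y) (\<lambda>X Y. 0)"
proof
  assume "mero_germ_eq (\<lambda>X Y. W_op (- X) Y) (\<lambda>X Y. 0)"
  then obtain h where h: "holo_germ h" "\<not> (\<forall>\<^sub>F (x, y) in nhds (0, 0). h x y = 0)"
    and ev: "\<forall>\<^sub>F (x, y) in nhds (0, 0). h x y \<noteq> 0 \<longrightarrow> W_op (- x) y = 0"
    unfolding mero_germ_eq_def nonzero_holo_germ_def by blast
  have small: "\<forall>\<^sub>F (x, y) in nhds (0, 0). norm (x::complex) < 1/16 \<and> norm (y::complex) < 1/16"
    unfolding eventually_nhds_00_iff by (intro exI[of _ "1/16"]) auto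
  from ev small have "\<forall>\<^sub>F (x, y) in nhds (0, 0). x \<noteq> 0 \<and> x + y \<noteq> 0 \<and> y - x \<noteq> 0 \<longrightarrow> h x y = 0"
    by eventually_elim (use W_identities(1) in auto)
  with h show False using holo_germ_eq_0_if_eq_0_off_lines by blast
qed

theorem mainTheorem8:
  shows "(\<forall>\<^sub>F (X, Y) in nhds (0, 0). cl_term X Y summable_on cl_index) \<and>
    (\<forall>\<^sub>F (X, Y) in nhds (0, 0). X \<noteq> 0 \<longrightarrow> op_term X Y summable_on op_index) \<and>
    mero_germ W_cl \<and>
    mero_germ W_op \<and>
    \<not> mero_germ_eq (\<lambda>X Y. W_op (- X) Y) (\<lambda>X Y. 0) \<and>
    mero_germ_eq W_cl
      (\<lambda>X Y. W_op X Y * inverse (W_op (- X) Y) / (X * (X + Y) * (X - Y))) \<and>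
    mero_germ_eq W_cl
      (\<lambda>X Y. 2 * X ^ 2 / of_real pi
         * ((sin (2 * of_real pi * X) * sin (of_real pi * (X + Y)) * sin (of_real pi * (Y - X)))
            / (sin (of_real pi * (X + Y)) + sin (of_real pi * (X - Y))) ^ 2)
         * W_op X Y ^ 2)"
proof (intro conjI mero_germ_W_cl mero_germ_W_op W_op_neg_germ_nonzero)
  show "\<forall>\<^sub>F (X, Y) in nhds (0, 0). cl_term X Y summable_on cl_index"
    unfolding eventually_nhds_00_iff
    by (intro exI[of _ "1/8"]) (auto intro: has_sum_imp_summable[OF cl_term_has_sum])
  show "\<forall>\<^sub>F (X, Y) in nhds (0, 0). X \<noteq> 0 \<longrightarrow> op_term X Y summable_on op_index"
    unfolding eventually_nhds_00_iff
    by (intro exI[of _ "1/8"]) (auto intro: has_sum_imp_summable[OF op_term_has_sum])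
qed (intro mero_germ_eqI W_identities; assumption)+

end
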